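(* Let $p\in\mathbb C$, $p\neq0$, and let $M$ be a nontrivial free conformal module of rank $(1+1)$ over $\mathfrak K(p)$. Then, up to parity change, $M\cong V^{(1)}_{\Delta,\alpha}$ or $M\cong V^{(2)}_{\Delta,\alpha}$ for some $\Delta,\alpha\in\mathbb C$.
   Context: A Lie conformal superalgebra is a $\mathbb Z/2\mathbb Z$-graded $\mathbb C[\partial]$-module $R=R_{\bar0}\oplus R_{\bar1}$ with a (parity-preserving) $\mathbb C$-linear $\lambda$-bracket $R\otimes R\to\mathbb C[\lambda]\otimes R$, $a\otimes b\mapsto[a\,{}_\lambda\, b]$, such that $[\partial a\,{}_\lambda\, b]=-\lambda[a\,{}_\lambda\, b]$, $[a\,{}_\lambda\,\partial b]=(\partial+\lambda)[a\,{}_\lambda\, b]$, $[a\,{}_\lambda\, b]=-(-1)^{|a||b|}[b\,{}_{-\lambda-\partial}\,a]$, $[a\,{}_\lambda[b\,{}_\mu c]]=[[a\,{}_\lambda b]\,{}_{\lambda+\mu}c]+(-1)^{|a||b|}[b\,{}_\mu[a\,{}_\lambda c]]$. A conformal $R$-module is a $\mathbb Z/2\mathbb Z$-graded $\mathbb C[\partial]$-module $M=M_{\bar0}\oplus M_{\bar1}$ with a (parity-preserving) $\mathbb C$-linear $\lambda$-action $R\otimes M\to\mathbb C[\lambda]\otimes M$, $a\otimes v\mapsto a\,{}_\lambda v$, such that $(\partial a)\,{}_\lambda v=-\lambda\, a\,{}_\lambda v$, $a\,{}_\lambda(\partial v)=(\partial+\lambda)a\,{}_\lambda v$, $[a\,{}_\lambda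 b]\,{}_{\lambda+\mu}v=a\,{}_\lambda(b\,{}_\mu v)-(-1)^{|a||b|}b\,{}_\mu(a\,{}_\lambda v)$. It is nontrivial if the $\lambda$-action is not identically zero; it is free of rank $(m+n)$ if $M_{\bar0}$, $M_{\bar1}$ are free $\mathbb C[\partial]$-modules of ranks $m$, $n$. "$M\cong V$ up to parity change" means $M\cong V$ or $M$ is isomorphic to $V$ with reversed parity. For nonzero $p\in\mathbb C$, $\mathfrak K(p)$ is the Lie conformal superalgebra whose even part has $\mathbb C[\partial]$-basis $\{L_i,J_i\mid i\in\mathbb Z_+\}$ and odd part has $\mathbb C[\partial]$-basis $\{G_i^\pm\mid i\in\mathbb Z_+\}$ ($\mathbb Z_+=\{0,1,2,\dots\}$), with $[L_i\,{}_\lambda L_j]=((i+p)\partial+(i+j+2p)\lambda)L_{i+j}$, $[L_i\,{}_\lambda J_j]=((i+p)\partial+(i+j+p)\lambda)J_{i+j}$, $[L_i\,{}_\lambda G^\pm_j]=((i+p)\partial+(i+j+\frac32p)\lambda)G^\pm_{i+j}$, $[J_i\,{}_\lambda G^\pm_j]=\pm G^\pm_{i+j}$, $[G^+_i\,{}_\lambda G^-_j]=((2i+p)\partial+2(i+j+p)\lambda)J_{i+j}+2L_{i+j}$, the other brackets of basis elements being given by skew-symmetry or zero. Fix a square root $\sqrt p$ of $p$. For $\Delta,\alpha\in\mathbb C$ (subscripts $\bar0,\bar1$ denote parity): $V^{(1)}_{\Delta,\alpha}=\mathbb C[\partial]v_{\bar0}\oplus\mathbb C[\partial]v_{\bar1}$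 (free): $L_0\,{}_\lambda v_{\bar0}=p(\partial+\Delta\lambda+\alpha)v_{\bar0}$, $L_0\,{}_\lambda v_{\bar1}=p(\partial+(\Delta+\frac12)\lambda+\alpha)v_{\bar1}$, $J_0\,{}_\lambda v_{\bar0}=-2\Delta v_{\bar0}$, $J_0\,{}_\lambda v_{\bar1}=(1-2\Delta)v_{\bar1}$, $G_0^+\,{}_\lambda v_{\bar0}=\sqrt p\,v_{\bar1}$, $G_0^+\,{}_\lambda v_{\bar1}=0$, $G_0^-\,{}_\lambda v_{\bar0}=0$, $G_0^-\,{}_\lambda v_{\bar1}=2\sqrt p(\partial+2\Delta\lambda+\alpha)v_{\bar0}$; $L_i,J_i,G_i^\pm$ act as zero for $i\ge1$. $V^{(2)}_{\Delta,\alpha}=\mathbb C[\partial]v_{\bar0}\oplus\mathbb C[\partial]v_{\bar1}$ (free): $L_0\,{}_\lambda v_{\bar0}=p(\partial+\Delta\lambda+\alpha)v_{\bar0}$, $L_0\,{}_\lambda v_{\bar1}=p(\partial+(\Delta+\frac12)\lambda+\alpha)v_{\bar1}$, $J_0\,{}_\lambda v_{\bar0}=2\Delta v_{\bar0}$, $J_0\,{}_\lambda v_{\bar1}=(2\Delta-1)v_{\bar1}$, $G_0^+\,{}_\lambda v_{\bar0}=0$, $G_0^+\,{}_\lambda v_{\bar1}=2\sqrt p(\partial+2\Delta\lambda+\alpha)v_{\bar0}$, $G_0^-\,{}_\lambda v_{\bar0}=\sqrt p\,v_{\bar1}$, $G_0^-\,{}_\lambda v_{\bar1}=0$; $L_i,J_i,G_i^\pm$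 act as zero for $i\ge1$. *)

theory Defs
  imports Complex_Main
    "HOL-Library.Poly_Mapping"
    "HOL-Library.Z2"
    "HOL-Computational_Algebra.Polynomial"
begin

section \<open>Polynomials with coefficients in a module\<close>

text \<open>
  \<open>\<complex>[\<partial>]\<close> is the ring \<^typ>\<open>complex poly\<close>, with \<open>\<partial>\<close> the polynomial \<open>[:0, 1:]\<close>.
  \<open>\<complex>[\<lambda>] \<otimes> M\<close> is \<open>'m poly\<close>: there \<^term>\<open>pCons 0\<close> is multiplication by \<open>\<lambda>\<close>, and a map on \<open>M\<close>
  acts coefficientwise by \<^const>\<open>map_poly\<close>.  \<open>\<complex>[\<lambda>, \<mu>] \<otimes> M\<close> is \<open>'m poly poly\<close>, the
  outer variable being \<open>\<mu>\<close> and the inner one \<open>\<lambda>\<close>.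
\<close>

text \<open>
  For \<open>q = \<Sum>n. x\<^sup>n q\<^sub>n\<close>, the value of \<open>\<Sum>n. x\<^sup>n f(q\<^sub>n)\<close> when the variable \<open>x\<close> is replaced by the
  operator \<open>X\<close>.
\<close>
definition subst_var :: "('w \<Rightarrow> 'w) \<Rightarrow> ('m \<Rightarrow> 'w) \<Rightarrow> 'm::zero poly \<Rightarrow> 'w::comm_monoid_add"
  where "subst_var X f q = (\<Sum>n\<le>degree q. (X ^^ n) (f (coeff q n)))"

definition lam :: "'m::ab_group_add poly poly \<Rightarrow> 'm poly poly"
  where "lam = map_poly (pCons 0)"

definition mu :: "'m::ab_group_add poly poly \<Rightarrow> 'm poly poly"
  where "mu = pCons 0"

definition at_var :: "('m poly poly \<Rightarrow> 'm poly poly) \<Rightarrow> 'm::ab_group_add poly \<Rightarrow> 'm poly poly"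
  where "at_var X = subst_var X (\<lambda>c. [:[:c:]:])"

text \<open>The sign \<open>(-1)\<^bsup>ij\<^esup>\<close>.\<close>
definition koszul :: "bit \<Rightarrow> bit \<Rightarrow> 'w::ab_group_add \<Rightarrow> 'w"
  where "koszul i j x = (if i = 1 \<and> j = 1 then - x else x)"


section \<open>Lie conformal superalgebras and conformal modules\<close>

locale super_module = module scale
  for scale :: "complex poly \<Rightarrow> 'm::ab_group_add \<Rightarrow> 'm" +
  fixes part :: "bit \<Rightarrow> 'm set"
  assumes subspace_part: "subspace (part i)"
    and part_Int: "part 0 \<inter> part 1 = {0}"
    and part_sum: "\<exists>y\<in>part 0. \<exists>z\<in>part 1. x = y + z"
begin

definition free_of_rank :: "nat \<Rightarrow> nat \<Rightarrow> bool"
  where "free_of_rank m n \<longleftrightarrow>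
    (\<exists>B. finite B \<and> card B = m \<and> independent B \<and> span B = part 0) \<and>
    (\<exists>B. finite B \<and> card B = n \<and> independent B \<and> span B = part 1)"

end

text \<open>
  The axioms shared by \<open>\<lambda>\<close>-brackets and \<open>\<lambda>\<close>-actions: \<open>\<complex>\<close>-bilinearity, preservation of parity,
  sesquilinearity.  The polynomial \<open>act a v\<close> is \<open>a \<^sub>\<lambda> v\<close>.
\<close>
locale lambda_product = R: super_module sR pR + M: super_module sM pM
  for sR :: "complex poly \<Rightarrow> 'r::ab_group_add \<Rightarrow> 'r" and pR :: "bit \<Rightarrow> 'r set"
    and sM :: "complex poly \<Rightarrow> 'm::ab_group_add \<Rightarrow> 'm" and pM :: "bit \<Rightarrow> 'm set" +
  fixes act :: "'r \<Rightarrow> 'm \<Rightarrow> 'm poly"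
  assumes add_left: "act (a + b) v = act a v + act b v"
    and add_right: "act a (v + w) = act a v + act a w"
    and scale_left: "act (sR [:c:] a) v = map_poly (sM [:c:]) (act a v)"
    and scale_right: "act a (sM [:c:] v) = map_poly (sM [:c:]) (act a v)"
    and parity: "a \<in> pR i \<Longrightarrow> v \<in> pM j \<Longrightarrow> coeff (act a v) n \<in> pM (i + j)"
    and del_left: "act (sR [:0, 1:] a) v = - pCons 0 (act a v)"
    and del_right: "act a (sM [:0, 1:] v) = map_poly (sM [:0, 1:]) (act a v) + pCons 0 (act a v)"

text \<open>
  In \<open>skew\<close> the variable of \<open>brk b a\<close> is replaced by the operator \<open>- \<lambda> - \<partial>\<close>.  In \<open>jacobi\<close> the
  three terms are \<open>[a \<^sub>\<lambda> [b \<^sub>\<mu> c]]\<close>, \<open>[[a \<^sub>\<lambda> b] \<^sub>\<lambda>\<^sub>+\<^sub>\<mu> c]\<close> and \<open>[b \<^sub>\<mu> [a \<^sub>\<lambda> c]]\<close>.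
\<close>
locale lie_conformal_superalgebra = lambda_product sR pR sR pR brk
  for sR :: "complex poly \<Rightarrow> 'r::ab_group_add \<Rightarrow> 'r" and pR :: "bit \<Rightarrow> 'r set"
    and brk :: "'r \<Rightarrow> 'r \<Rightarrow> 'r poly" +
  assumes skew: "a \<in> pR i \<Longrightarrow> b \<in> pR j \<Longrightarrow>
      brk a b = - koszul i j
        (subst_var (\<lambda>x. - pCons 0 x - map_poly (sR [:0, 1:]) x) (\<lambda>c. [:c:]) (brk b a))"
    and jacobi: "a \<in> pR i \<Longrightarrow> b \<in> pR j \<Longrightarrow>
      subst_var mu (\<lambda>w. at_var lam (brk a w)) (brk b c) =
        subst_var lam (\<lambda>w. at_var (\<lambda>x. lam x + mu x) (brk w c)) (brk a b)
        + koszul i j (subst_var lam (\<lambda>w. at_var mu (brk b w)) (brk a c))"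

locale conformal_module = lie_conformal_superalgebra sR pR brk + Act: lambda_product sR pR sM pM act
  for sR :: "complex poly \<Rightarrow> 'r::ab_group_add \<Rightarrow> 'r" and pR :: "bit \<Rightarrow> 'r set"
    and brk :: "'r \<Rightarrow> 'r \<Rightarrow> 'r poly"
    and sM :: "complex poly \<Rightarrow> 'm::ab_group_add \<Rightarrow> 'm" and pM :: "bit \<Rightarrow> 'm set"
    and act :: "'r \<Rightarrow> 'm \<Rightarrow> 'm poly" +
  assumes module_jacobi: "a \<in> pR i \<Longrightarrow> b \<in> pR j \<Longrightarrow>
      subst_var lam (\<lambda>w. at_var (\<lambda>x. lam x + mu x) (act w v)) (brk a b) =
        subst_var mu (\<lambda>w. at_var lam (act a w)) (act b v)
        - koszul i j (subst_var lam (\<lambda>w. at_var mu (act b w)) (act a v))"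

definition nontrivial_action :: "('r \<Rightarrow> 'm \<Rightarrow> 'm::zero poly) \<Rightarrow> bool"
  where "nontrivial_action act \<longleftrightarrow> (\<exists>a v. act a v \<noteq> 0)"

definition conformal_iso ::
  "(complex poly \<Rightarrow> 'm::ab_group_add \<Rightarrow> 'm) \<Rightarrow> (bit \<Rightarrow> 'm set) \<Rightarrow> ('r \<Rightarrow> 'm \<Rightarrow> 'm poly) \<Rightarrow>
   (complex poly \<Rightarrow> 'n::ab_group_add \<Rightarrow> 'n) \<Rightarrow> (bit \<Rightarrow> 'n set) \<Rightarrow> ('r \<Rightarrow> 'n \<Rightarrow> 'n poly) \<Rightarrow> bool"
  where "conformal_iso sM pM actM sN pN actN \<longleftrightarrow>
    (\<exists>f. module_hom sM sN f \<and> bij f \<and> (\<forall>i. f ` pM i = pN i) \<and>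
         (\<forall>a v. actN a (f v) = map_poly f (actM a v)))"

definition reversed :: "(bit \<Rightarrow> 'm set) \<Rightarrow> bit \<Rightarrow> 'm set"
  where "reversed part i = part (i + 1)"

definition conformal_iso_up_to_parity ::
  "(complex poly \<Rightarrow> 'm::ab_group_add \<Rightarrow> 'm) \<Rightarrow> (bit \<Rightarrow> 'm set) \<Rightarrow> ('r \<Rightarrow> 'm \<Rightarrow> 'm poly) \<Rightarrow>
   (complex poly \<Rightarrow> 'n::ab_group_add \<Rightarrow> 'n) \<Rightarrow> (bit \<Rightarrow> 'n set) \<Rightarrow> ('r \<Rightarrow> 'n \<Rightarrow> 'n poly) \<Rightarrow> bool"
  where "conformal_iso_up_to_parity sM pM actM sN pN actN \<longleftrightarrow>
    conformal_iso sM pM actM sN pN actN \<or> conformal_iso sM pM actM sN (reversed pN) actN"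


section \<open>Free modules and sesquilinear extension\<close>

text \<open>The free \<open>\<complex>[\<partial>]\<close>-module with basis \<open>'b\<close> is \<open>'b \<Rightarrow>\<^sub>0 complex poly\<close>.\<close>

definition fscale :: "complex poly \<Rightarrow> ('b \<Rightarrow>\<^sub>0 complex poly) \<Rightarrow> ('b \<Rightarrow>\<^sub>0 complex poly)"
  where "fscale r a = Poly_Mapping.map (\<lambda>q. r * q) a"

definition gen :: "'b \<Rightarrow> ('b \<Rightarrow>\<^sub>0 complex poly)"
  where "gen x = Poly_Mapping.single x 1"

definition fpart :: "('b \<Rightarrow> bit) \<Rightarrow> bit \<Rightarrow> ('b \<Rightarrow>\<^sub>0 complex poly) set"
  where "fpart par i = {a. \<forall>x\<in>Poly_Mapping.keys a. par x = i}"

definition minus_lam :: "('b \<Rightarrow>\<^sub>0 complex poly) poly \<Rightarrow> ('b \<Rightarrow>\<^sub>0 complex poly) poly"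
  where "minus_lam w = - pCons 0 w"

definition del_plus_lam :: "('b \<Rightarrow>\<^sub>0 complex poly) poly \<Rightarrow> ('b \<Rightarrow>\<^sub>0 complex poly) poly"
  where "del_plus_lam w = map_poly (fscale [:0, 1:]) w + pCons 0 w"

text \<open>\<open>op_poly T q w = q(T) w\<close>\<close>
definition op_poly :: "(('b \<Rightarrow>\<^sub>0 complex poly) poly \<Rightarrow> ('b \<Rightarrow>\<^sub>0 complex poly) poly) \<Rightarrow>
    complex poly \<Rightarrow> ('b \<Rightarrow>\<^sub>0 complex poly) poly \<Rightarrow> ('b \<Rightarrow>\<^sub>0 complex poly) poly"
  where "op_poly T q w = subst_var T (\<lambda>c. map_poly (fscale [:c:]) w) q"

text \<open>
  The \<open>\<lambda>\<close>-product with given values \<open>\<beta> x y\<close> on basis elements: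
  \<open>(f(\<partial>) x) \<^sub>\<lambda> (g(\<partial>) y) = f(-\<lambda>) g(\<partial> + \<lambda>) (x \<^sub>\<lambda> y)\<close>.
\<close>
definition sesqui_ext :: "('b \<Rightarrow> 'c \<Rightarrow> ('c \<Rightarrow>\<^sub>0 complex poly) poly) \<Rightarrow>
    ('b \<Rightarrow>\<^sub>0 complex poly) \<Rightarrow> ('c \<Rightarrow>\<^sub>0 complex poly) \<Rightarrow> ('c \<Rightarrow>\<^sub>0 complex poly) poly"
  where "sesqui_ext \<beta> a v =
    (\<Sum>x\<in>Poly_Mapping.keys a. \<Sum>y\<in>Poly_Mapping.keys v.
       op_poly minus_lam (Poly_Mapping.lookup a x)
         (op_poly del_plus_lam (Poly_Mapping.lookup v y) (\<beta> x y)))"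

text \<open>\<open>lin a b c x = (a\<partial> + b\<lambda> + c) x\<close>\<close>
definition lin :: "complex \<Rightarrow> complex \<Rightarrow> complex \<Rightarrow> 'b \<Rightarrow> ('b \<Rightarrow>\<^sub>0 complex poly) poly"
  where "lin a b c x = [:fscale [:c, a:] (gen x), fscale [:b:] (gen x):]"


section \<open>The Lie conformal superalgebra \<open>\<KK>(p)\<close>\<close>

datatype K_basis = K_L nat | K_J nat | K_Gp nat | K_Gm nat

fun K_par :: "K_basis \<Rightarrow> bit"
  where
    "K_par (K_L i) = 0"
  | "K_par (K_J i) = 0"
  | "K_par (K_Gp i) = 1"
  | "K_par (K_Gm i) = 1"

type_synonym K_elem = "K_basis \<Rightarrow>\<^sub>0 complex poly"

text \<open>
  The products not displayed in the usual presentation (\<open>J L\<close>, \<open>G\<^sup>\<plusminus> L\<close>, \<open>G\<^sup>\<plusminus> J\<close>, \<open>G\<^sup>- G\<^sup>+\<close>) are the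
  values forced by skew-symmetry; that they are correct is part of
  \<open>lie_conformal_superalgebra_K\<close> below.
\<close>
fun K_table :: "complex \<Rightarrow> K_basis \<Rightarrow> K_basis \<Rightarrow> K_elem poly"
  where
    "K_table p (K_L i) (K_L j) = lin (of_nat i + p) (of_nat (i + j) + 2 * p) 0 (K_L (i + j))"
  | "K_table p (K_L i) (K_J j) = lin (of_nat i + p) (of_nat (i + j) + p) 0 (K_J (i + j))"
  | "K_table p (K_L i) (K_Gp j) = lin (of_nat i + p) (of_nat (i + j) + 3 / 2 * p) 0 (K_Gp (i + j))"
  | "K_table p (K_L i) (K_Gm j) = lin (of_nat i + p) (of_nat (i + j) + 3 / 2 * p) 0 (K_Gm (i + j))"
  | "K_table p (K_J i) (K_Gp j) = lin 0 0 1 (K_Gp (i + j))"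
  | "K_table p (K_J i) (K_Gm j) = lin 0 0 (- 1) (K_Gm (i + j))"
  | "K_table p (K_Gp i) (K_Gm j) =
       lin (2 * of_nat i + p) (2 * (of_nat (i + j) + p)) 0 (K_J (i + j)) + lin 0 0 2 (K_L (i + j))"
  | "K_table p (K_J i) (K_L j) = lin (of_nat i) (of_nat (i + j) + p) 0 (K_J (i + j))"
  | "K_table p (K_Gp i) (K_L j) = lin (of_nat i + p / 2) (of_nat (i + j) + 3 / 2 * p) 0 (K_Gp (i + j))"
  | "K_table p (K_Gm i) (K_L j) = lin (of_nat i + p / 2) (of_nat (i + j) + 3 / 2 * p) 0 (K_Gm (i + j))"
  | "K_table p (K_Gp i) (K_J j) = lin 0 0 (- 1) (K_Gp (i + j))"
  | "K_table p (K_Gm i) (K_J j) = lin 0 0 1 (K_Gm (i + j))"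
  | "K_table p (K_Gm i) (K_Gp j) =
       lin (- 2 * of_nat i - p) (- 2 * (of_nat (i + j) + p)) 0 (K_J (i + j)) + lin 0 0 2 (K_L (i + j))"
  | "K_table p (K_J i) (K_J j) = 0"
  | "K_table p (K_Gp i) (K_Gp j) = 0"
  | "K_table p (K_Gm i) (K_Gm j) = 0"

definition K_brk :: "complex \<Rightarrow> K_elem \<Rightarrow> K_elem \<Rightarrow> K_elem poly"
  where "K_brk p = sesqui_ext (K_table p)"

abbreviation K_part :: "bit \<Rightarrow> K_elem set"
  where "K_part \<equiv> fpart K_par"


section \<open>The modules \<open>V\<^sup>(\<^sup>1\<^sup>)\<close> and \<open>V\<^sup>(\<^sup>2\<^sup>)\<close>\<close>

text \<open>
  The basis elements \<open>v\<^sub>0\<close>, \<open>v\<^sub>1\<close> are indexed by their parity in \<^typ>\<open>bit\<close>; the argument \<open>s\<close> is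
  the chosen square root of \<open>p\<close>.
\<close>

type_synonym V_elem = "bit \<Rightarrow>\<^sub>0 complex poly"

fun V1_table :: "complex \<Rightarrow> complex \<Rightarrow> complex \<Rightarrow> complex \<Rightarrow> K_basis \<Rightarrow> bit \<Rightarrow> V_elem poly"
  where
    "V1_table p s \<Delta> \<alpha> (K_L 0) y =
       (if y = 0 then lin p (p * \<Delta>) (p * \<alpha>) 0 else lin p (p * (\<Delta> + 1 / 2)) (p * \<alpha>) 1)"
  | "V1_table p s \<Delta> \<alpha> (K_J 0) y = (if y = 0 then lin 0 0 (- 2 * \<Delta>) 0 else lin 0 0 (1 - 2 * \<Delta>) 1)"
  | "V1_table p s \<Delta> \<alpha> (K_Gp 0) y = (if y = 0 then lin 0 0 s 1 else 0)"
  | "V1_table p s \<Delta> \<alpha> (K_Gm 0) y = (if y = 0 then 0 else lin (2 * s) (2 * s * (2 * \<Delta>)) (2 * s * \<alpha>) 0)"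
  | "V1_table p s \<Delta> \<alpha> (K_L (Suc i)) y = 0"
  | "V1_table p s \<Delta> \<alpha> (K_J (Suc i)) y = 0"
  | "V1_table p s \<Delta> \<alpha> (K_Gp (Suc i)) y = 0"
  | "V1_table p s \<Delta> \<alpha> (K_Gm (Suc i)) y = 0"

fun V2_table :: "complex \<Rightarrow> complex \<Rightarrow> complex \<Rightarrow> complex \<Rightarrow> K_basis \<Rightarrow> bit \<Rightarrow> V_elem poly"
  where
    "V2_table p s \<Delta> \<alpha> (K_L 0) y =
       (if y = 0 then lin p (p * \<Delta>) (p * \<alpha>) 0 else lin p (p * (\<Delta> + 1 / 2)) (p * \<alpha>) 1)"
  | "V2_table p s \<Delta> \<alpha> (K_J 0) y = (if y = 0 then lin 0 0 (2 * \<Delta>) 0 else lin 0 0 (2 * \<Delta> - 1) 1)"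
  | "V2_table p s \<Delta> \<alpha> (K_Gp 0) y = (if y = 0 then 0 else lin (2 * s) (2 * s * (2 * \<Delta>)) (2 * s * \<alpha>) 0)"
  | "V2_table p s \<Delta> \<alpha> (K_Gm 0) y = (if y = 0 then lin 0 0 s 1 else 0)"
  | "V2_table p s \<Delta> \<alpha> (K_L (Suc i)) y = 0"
  | "V2_table p s \<Delta> \<alpha> (K_J (Suc i)) y = 0"
  | "V2_table p s \<Delta> \<alpha> (K_Gp (Suc i)) y = 0"
  | "V2_table p s \<Delta> \<alpha> (K_Gm (Suc i)) y = 0"

definition V1_act :: "complex \<Rightarrow> complex \<Rightarrow> complex \<Rightarrow> complex \<Rightarrow> K_elem \<Rightarrow> V_elem \<Rightarrow> V_elem poly"
  where "V1_act p s \<Delta> \<alpha> = sesqui_ext (V1_table p s \<Delta> \<alpha>)"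

definition V2_act :: "complex \<Rightarrow> complex \<Rightarrow> complex \<Rightarrow> complex \<Rightarrow> K_elem \<Rightarrow> V_elem \<Rightarrow> V_elem poly"
  where "V2_act p s \<Delta> \<alpha> = sesqui_ext (V2_table p s \<Delta> \<alpha>)"

abbreviation V_part :: "bit \<Rightarrow> V_elem set"
  where "V_part \<equiv> fpart (\<lambda>y. y)"


section \<open>\<open>\<KK>(p)\<close> is a Lie conformal superalgebra\<close>

lemma additive_funpow:
  fixes X :: "'a::ab_group_add \<Rightarrow> 'a"
  assumes "additive X" shows "additive (X ^^ n)"
  by (induction n) (auto simp: additive_def additive.add[OF assms])

lemma subst_var_upper:
  fixes f :: "'m::zero \<Rightarrow> 'w::ab_group_add"
  assumes "additive X" "f 0 = 0" "degree q \<le> N"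
  shows "subst_var X f q = (\<Sum>n\<le>N. (X ^^ n) (f (coeff q n)))"
  unfolding subst_var_def
  by (rule sum.mono_neutral_left)
     (use assms in \<open>auto simp: coeff_eq_0 additive.zero[OF additive_funpow]\<close>)

lemma subst_var_0:
  fixes f :: "'m::zero \<Rightarrow> 'w::ab_group_add"
  shows "f 0 = 0 \<Longrightarrow> subst_var X f 0 = 0"
  by (simp add: subst_var_def)

lemma subst_var_pCons:
  fixes f :: "'m::zero \<Rightarrow> 'w::ab_group_add"
  assumes X: "additive X" and f: "f 0 = 0"
  shows "subst_var X f (pCons a q) = f a + X (subst_var X f q)"
proof -
  have "subst_var X f (pCons a q) = (\<Sum>n\<le>Suc (degree q). (X ^^ n) (f (coeff (pCons a q) n)))"
    by (rule subst_var_upper[OF X]) (auto simp: f degree_pCons_le)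
  also have "\<dots> = f a + (\<Sum>n\<le>degree q. X ((X ^^ n) (f (coeff q n))))"
    by (subst sum.atMost_Suc_shift) simp
  also have "\<dots> = f a + X (subst_var X f q)"
    by (simp add: subst_var_def additive.sum[OF X])
  finally show ?thesis .
qed

lemma subst_var_add:
  fixes f :: "'m::ab_group_add \<Rightarrow> 'w::ab_group_add"
  assumes X: "additive X" and f: "additive f"
  shows "subst_var X f (q + r) = subst_var X f q + subst_var X f r"
proof (induction q arbitrary: r)
  case 0 then show ?case by (simp add: subst_var_0 additive.zero[OF f])
next
  case (pCons a q)
  note step = subst_var_pCons[where X = X and f = f, OF X additive.zero[OF f]]
  show ?case
    by (cases r) (simp add: step pCons.IH additive.add[OF f] additive.add[OF X])
qed

lemma subst_var_fun_add:
  fixes f g :: "'m::zero \<Rightarrow> 'w::ab_group_add"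
  assumes "additive X"
  shows "subst_var X (\<lambda>c. f c + g c) q = subst_var X f q + subst_var X g q"
  by (simp add: subst_var_def additive.add[OF additive_funpow[OF assms]] sum.distrib)

lemma subst_var_minus:
  fixes f :: "'m::ab_group_add \<Rightarrow> 'w::ab_group_add"
  assumes X: "additive X" and f: "additive f"
  shows "subst_var X f (- q) = - subst_var X f q"
  using additive.minus[of "subst_var X f" q] subst_var_add[OF assms]
  by (auto simp: additive_def)

lemma subst_var_map_poly:
  fixes f :: "'m::zero \<Rightarrow> 'w::ab_group_add" and g :: "'n::zero \<Rightarrow> 'm"
  assumes "additive X" "f 0 = 0" "g 0 = 0"
  shows "subst_var X f (map_poly g q) = subst_var X (\<lambda>c. f (g c)) q"
  by (subst subst_var_upper[where N = "degree q"])
     (use assms in \<open>auto simp: map_poly_degree_leq coeff_map_poly subst_var_def\<close>)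

lemma subst_var_commute:
  fixes f :: "'m::zero \<Rightarrow> 'w::ab_group_add"
  assumes X: "additive X" and Y: "additive Y" and XY: "\<And>z. Y (X z) = X' (Y z)"
  shows "Y (subst_var X f q) = subst_var X' (\<lambda>c. Y (f c)) q"
proof -
  have "Y ((X ^^ n) z) = (X' ^^ n) (Y z)" for n z
    by (induction n) (auto simp: XY)
  then show ?thesis by (simp add: subst_var_def additive.sum[OF Y])
qed

lemma map_poly_add':
  assumes "additive f"
  shows "map_poly f (p + q) = map_poly f p + map_poly f q"
  by (rule poly_eqI) (simp add: coeff_map_poly additive.zero[OF assms] additive.add[OF assms])

lemma additive_map_poly: "additive f \<Longrightarrow> additive (map_poly f)"
  by (simp add: additive_def map_poly_add')

lemma additive_pCons: "additive (pCons (0::'m::ab_group_add))"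
  by (simp add: additive_def)

lemma additive_lam: "additive lam" and additive_mu: "additive mu"
  by (simp_all add: lam_def mu_def additive_pCons additive_map_poly)

lemma additive_plus: "additive f \<Longrightarrow> additive g \<Longrightarrow> additive (\<lambda>x. f x + g x)"
  and additive_diff: "additive f \<Longrightarrow> additive g \<Longrightarrow> additive (\<lambda>x. f x - g x)"
  and additive_uminus: "additive f \<Longrightarrow> additive (\<lambda>x. - f x)"
  by (simp_all add: additive_def)

lemma additive_comp: "additive f \<Longrightarrow> additive g \<Longrightarrow> additive (\<lambda>x. f (g x))"
  by (simp add: additive_def)

lemma additive_const1: "additive (\<lambda>c::'m::ab_group_add. [:c:])"
  and additive_const: "additive (\<lambda>c::'m::ab_group_add. [:[:c:]:])"
  by (simp_all add: additive_def)

lemma additive_subst_var: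
  fixes f :: "'m::ab_group_add \<Rightarrow> 'w::ab_group_add"
  shows "additive X \<Longrightarrow> additive f \<Longrightarrow> additive (subst_var X f)"
  by (simp add: additive_def subst_var_add)

lemma additive_at_var: "additive X \<Longrightarrow> additive (at_var X)"
  by (simp add: at_var_def additive_subst_var additive_const)

lemmas additives = additive_map_poly additive_pCons additive_lam additive_mu additive_plus
  additive_diff additive_uminus additive_const1 additive_const additive_subst_var additive_at_var

lemma map_poly_mu: "g 0 = 0 \<Longrightarrow> map_poly (map_poly g) (mu x) = mu (map_poly (map_poly g) x)"
  by (simp add: mu_def map_poly_pCons)

lemma map_poly_lam: "g 0 = 0 \<Longrightarrow> map_poly (map_poly g) (lam x) = lam (map_poly (map_poly g) x)"
  by (simp add: lam_def map_poly_map_poly o_def map_poly_pCons)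

lemma lam_mu: "lam (mu x) = mu (lam x)"
  by (simp add: lam_def mu_def map_poly_pCons)


subsection \<open>The module of finitely supported functions\<close>

lemma lookup_fscale: "Poly_Mapping.lookup (fscale r a) x = r * Poly_Mapping.lookup a x"
  by (simp add: fscale_def Poly_Mapping.map.rep_eq when_def)

lemma fscale_single: "fscale r (Poly_Mapping.single x q) = Poly_Mapping.single x (r * q)"
  by (rule poly_mapping_eqI) (simp add: lookup_fscale lookup_single when_def)

interpretation free: module fscale
  by standard (auto intro!: poly_mapping_eqI simp: lookup_fscale lookup_add algebra_simps)

lemma additive_fscale: "additive (fscale r)"
  by (simp add: additive_def free.scale_right_distrib)

lemma fpart_iff: "a \<in> fpart par i \<longleftrightarrow> (\<forall>x. par x \<noteq> i \<longrightarrow> Poly_Mapping.lookup a x = 0)"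
  by (auto simp: fpart_def in_keys_iff)

lemma free_super_module: "super_module fscale (fpart par)"
proof -
  show ?thesis
  proof
    fix i show "free.subspace (fpart par i)"
      by (auto simp: free.subspace_def fpart_iff lookup_add lookup_fscale)
    show "fpart par 0 \<inter> fpart par 1 = {0}"
    proof -
      have "x = 0" if "x \<in> fpart par 0" "x \<in> fpart par 1" for x
        using that by (intro poly_mapping_eqI) (metis fpart_iff lookup_zero zero_neq_one)
      then show ?thesis by (auto simp: fpart_iff)
    qed
    fix x :: "'a \<Rightarrow>\<^sub>0 complex poly"
    define h where "h j = Poly_Mapping.mapp (\<lambda>k q. if par k = j then q else 0) x" for j
    have h: "Poly_Mapping.lookup (h j) k = (if par k = j then Poly_Mapping.lookup x k else 0)" for j k
      by (auto simp: h_def lookup_mapp when_def in_keys_iff)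
    show "\<exists>y\<in>fpart par 0. \<exists>z\<in>fpart par 1. x = y + z"
    proof (intro bexI)
      show "x = h 0 + h 1"
        by (rule poly_mapping_eqI) (auto simp: lookup_add h)
    qed (auto simp: fpart_iff h)
  qed
qed

lemma fpart_induct [consumes 1, case_names zero add scale del gen]:
  assumes a: "a \<in> fpart par i"
    and zero: "P 0" and add: "\<And>a b. P a \<Longrightarrow> P b \<Longrightarrow> P (a + b)"
    and scale: "\<And>c a. P a \<Longrightarrow> P (fscale [:c:] a)" and del: "\<And>a. P a \<Longrightarrow> P (fscale [:0, 1:] a)"
    and gen: "\<And>x. par x = i \<Longrightarrow> P (gen x)"
  shows "P a"
proof -
  have s: "P (Poly_Mapping.single x q)" if "par x = i" for x q
  proof (induction q)
    case 0 show ?case using zero by simp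
  next
    case (pCons c q)
    have "Poly_Mapping.single x (pCons c q)
        = fscale [:c:] (gen x) + fscale [:0, 1:] (Poly_Mapping.single x q)"
      by (simp add: gen_def fscale_single flip: single_add)
    then show ?case using add scale del gen[OF that] pCons.IH by metis
  qed
  have S: "P (\<Sum>x\<in>S. Poly_Mapping.single x (Poly_Mapping.lookup a x))"
    if "finite S" "\<And>x. x \<in> S \<Longrightarrow> par x = i" for S
    using that by (induction S rule: finite_induct) (auto simp: zero intro!: add s)
  have "(\<Sum>x\<in>Poly_Mapping.keys a. Poly_Mapping.single x (Poly_Mapping.lookup a x)) = a"
    by (rule poly_mapping_eqI)
       (auto simp: lookup_sum lookup_single when_def sum.If_cases in_keys_iff
          intro: sum.delta'[THEN trans])
  with S[of "Poly_Mapping.keys a"] a show ?thesis by (auto simp: fpart_def)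
qed


subsection \<open>The sesquilinear extension\<close>

lemma fscale_poly_add:
  "map_poly (fscale (r + s)) w = map_poly (fscale r) w + map_poly (fscale s) w"
  by (rule poly_eqI) (simp add: coeff_map_poly free.scale_left_distrib)

lemma fscale_poly_mult:
  "map_poly (fscale r) (map_poly (fscale s) w) = map_poly (fscale (r * s)) w"
  by (rule poly_eqI) (simp add: coeff_map_poly)

lemma additive_scalars: "additive (\<lambda>c. map_poly (fscale [:c:]) w)"
proof -
  have "[:c + d:] = [:c:] + [:d:]" for c d :: complex by simp
  then show ?thesis by (simp only: additive_def fscale_poly_add simp_thms)
qed

lemma map_poly_fscale_0: "map_poly (fscale 0) w = 0"
  by (rule poly_eqI) (simp add: coeff_map_poly)

lemma op_poly_pCons:
  "additive T \<Longrightarrow> op_poly T (pCons c q) w = map_poly (fscale [:c:]) w + T (op_poly T q w)"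
  unfolding op_poly_def
  by (rule subst_var_pCons) (simp_all add: map_poly_fscale_0 additive_scalars)

lemma op_poly_0: "op_poly T 0 w = 0"
  by (simp add: op_poly_def subst_var_0 map_poly_fscale_0)

lemma op_poly_1:
  assumes "additive T" shows "op_poly T 1 w = w"
proof -
  have "op_poly T [:1:] w = w"
    using assms by (simp only: op_poly_pCons op_poly_0 additive.zero)
      (simp add: map_poly_idI flip: one_pCons)
  then show ?thesis by (simp only: one_pCons)
qed

lemma op_poly_add: "additive T \<Longrightarrow> op_poly T (q + r) w = op_poly T q w + op_poly T r w"
  unfolding op_poly_def by (rule subst_var_add) (rule additive_scalars | assumption)+

lemma additive_op_poly: "additive T \<Longrightarrow> additive (op_poly T q)"
  unfolding additive_def op_poly_def
  by (simp add: map_poly_add'[OF additive_fscale] subst_var_fun_add[unfolded additive_def])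

lemma op_poly_commute:
  assumes "additive T" "additive Y" "\<And>z. Y (T z) = T (Y z)"
    "\<And>c z. Y (map_poly (fscale [:c:]) z) = map_poly (fscale [:c:]) (Y z)"
  shows "Y (op_poly T q w) = op_poly T q (Y w)"
  unfolding op_poly_def by (subst subst_var_commute[where X' = T]) (use assms in auto)

lemma op_poly_scale:
  assumes T: "additive T" and c: "\<And>z. map_poly (fscale [:c:]) (T z) = T (map_poly (fscale [:c:]) z)"
  shows "op_poly T ([:c:] * q) w = map_poly (fscale [:c:]) (op_poly T q w)"
proof (induction q)
  case 0 show ?case by (simp add: op_poly_0)
next
  case (pCons d q)
  have "op_poly T ([:c:] * pCons d q) w = map_poly (fscale ([:c:] * [:d:])) w + T (op_poly T ([:c:] * q) w)"
    using T by (simp add: op_poly_pCons)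
  also have "\<dots> = map_poly (fscale [:c:]) (op_poly T (pCons d q) w)"
    by (simp only: pCons.IH op_poly_pCons[OF T] map_poly_add'[OF additive_fscale]
        fscale_poly_mult c)
  finally show ?case .
qed

lemma additive_minus_lam: "additive minus_lam" and additive_del_plus_lam: "additive del_plus_lam"
  by (auto simp: additive_def minus_lam_def del_plus_lam_def map_poly_add'[OF additive_fscale])

lemma map_poly_fscale_minus: "map_poly (fscale r) (- w) = - map_poly (fscale r) w"
  by (rule additive.minus[OF additive_map_poly[OF additive_fscale]])

lemma minus_lam_del_plus_lam: "minus_lam (del_plus_lam z) = del_plus_lam (minus_lam z)"
  by (simp add: minus_lam_def del_plus_lam_def map_poly_fscale_minus map_poly_pCons)

lemma scale_minus_lam: "map_poly (fscale [:c:]) (minus_lam z) = minus_lam (map_poly (fscale [:c:]) z)"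
  by (simp add: minus_lam_def map_poly_fscale_minus map_poly_pCons)

lemma scale_del_plus_lam: "map_poly (fscale [:c:]) (del_plus_lam z) = del_plus_lam (map_poly (fscale [:c:]) z)"
  by (simp add: del_plus_lam_def map_poly_add'[OF additive_fscale] map_poly_pCons fscale_poly_mult
      mult.commute)

abbreviation (input) "ext_term \<beta> a v x y \<equiv>
  op_poly minus_lam (Poly_Mapping.lookup a x) (op_poly del_plus_lam (Poly_Mapping.lookup v y) (\<beta> x y))"

lemma sesqui_ext_superset:
  assumes "finite S" "Poly_Mapping.keys a \<subseteq> S" "finite T" "Poly_Mapping.keys v \<subseteq> T"
  shows "sesqui_ext \<beta> a v = (\<Sum>x\<in>S. \<Sum>y\<in>T. ext_term \<beta> a v x y)"
proof -
  have "sesqui_ext \<beta> a v = (\<Sum>x\<in>Poly_Mapping.keys a. \<Sum>y\<in>T. ext_term \<beta> a v x y)"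
    unfolding sesqui_ext_def
    by (intro sum.cong[OF refl] sum.mono_neutral_left)
       (use assms in \<open>auto simp: in_keys_iff op_poly_0 additive.zero[OF additive_op_poly[OF additive_minus_lam]]\<close>)
  also have "\<dots> = (\<Sum>x\<in>S. \<Sum>y\<in>T. ext_term \<beta> a v x y)"
    by (intro sum.mono_neutral_left) (use assms in \<open>auto simp: in_keys_iff op_poly_0\<close>)
  finally show ?thesis .
qed

lemma keys_fscale: "Poly_Mapping.keys (fscale r a) \<subseteq> Poly_Mapping.keys a"
  by (auto simp: in_keys_iff lookup_fscale)

lemma sesqui_ext_gen: "sesqui_ext \<beta> (gen x) (gen y) = \<beta> x y"
  by (simp add: sesqui_ext_def gen_def op_poly_1 additive_minus_lam additive_del_plus_lam)

lemma sesqui_ext_add_left: "sesqui_ext \<beta> (a + b) v = sesqui_ext \<beta> a v + sesqui_ext \<beta> b v"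
proof -
  let ?S = "Poly_Mapping.keys a \<union> Poly_Mapping.keys b"
  have *: "finite ?S" "Poly_Mapping.keys a \<subseteq> ?S" "Poly_Mapping.keys b \<subseteq> ?S"
    "Poly_Mapping.keys (a + b) \<subseteq> ?S"
    using keys_add[of a b] by auto
  show ?thesis
    by (simp add: sesqui_ext_superset[OF *(1,2) finite_keys order_refl]
        sesqui_ext_superset[OF *(1,3) finite_keys order_refl]
        sesqui_ext_superset[OF *(1,4) finite_keys order_refl]
        lookup_add op_poly_add[OF additive_minus_lam] sum.distrib)
qed

lemma sesqui_ext_add_right: "sesqui_ext \<beta> a (v + w) = sesqui_ext \<beta> a v + sesqui_ext \<beta> a w"
proof -
  let ?S = "Poly_Mapping.keys v \<union> Poly_Mapping.keys w"
  have *: "finite ?S" "Poly_Mapping.keys v \<subseteq> ?S" "Poly_Mapping.keys w \<subseteq> ?S"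
    "Poly_Mapping.keys (v + w) \<subseteq> ?S"
    using keys_add[of v w] by auto
  show ?thesis
    by (simp add: sesqui_ext_superset[OF finite_keys order_refl *(1,2)]
        sesqui_ext_superset[OF finite_keys order_refl *(1,3)]
        sesqui_ext_superset[OF finite_keys order_refl *(1,4)]
        lookup_add op_poly_add[OF additive_del_plus_lam] additive.add[OF additive_op_poly[OF additive_minus_lam]]
        sum.distrib)
qed

lemma sesqui_ext_left:
  assumes Y: "additive Y" and "\<And>q w. op_poly minus_lam (r * q) w = Y (op_poly minus_lam q w)"
  shows "sesqui_ext \<beta> (fscale r a) v = Y (sesqui_ext \<beta> a v)"
  unfolding sesqui_ext_superset[OF finite_keys keys_fscale finite_keys order_refl, of \<beta> r a v]
    sesqui_ext_superset[OF finite_keys[of a] order_refl finite_keys order_refl]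
  by (simp add: lookup_fscale assms(2) additive.sum[OF Y])

lemma sesqui_ext_right:
  assumes Y: "additive Y" and "\<And>q w. op_poly del_plus_lam (r * q) w = Y (op_poly del_plus_lam q w)"
    and "\<And>q w. op_poly minus_lam q (Y w) = Y (op_poly minus_lam q w)"
  shows "sesqui_ext \<beta> a (fscale r v) = Y (sesqui_ext \<beta> a v)"
  unfolding sesqui_ext_superset[OF finite_keys order_refl finite_keys keys_fscale, of \<beta> a r v]
    sesqui_ext_superset[OF finite_keys order_refl finite_keys[of v] order_refl]
  by (simp add: lookup_fscale assms(2,3) additive.sum[OF Y])

lemma op_poly_del: "additive T \<Longrightarrow> op_poly T ([:0, 1:] * q) w = T (op_poly T q w)"
  by (simp add: op_poly_pCons map_poly_fscale_0)

lemma sum_closed: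
  assumes "0 \<in> Q" "\<And>q r. q \<in> Q \<Longrightarrow> r \<in> Q \<Longrightarrow> q + r \<in> Q" "\<And>x. x \<in> S \<Longrightarrow> f x \<in> Q"
  shows "sum f S \<in> Q"
  using assms(3) by (induction S rule: infinite_finite_induct) (auto simp: assms(1,2))

lemma scale_scale_commute:
  "map_poly (fscale [:c:]) (map_poly (fscale [:d:]) z) = map_poly (fscale [:d:]) (map_poly (fscale [:c:]) z)"
  by (simp add: fscale_poly_mult mult.commute)

lemma sesqui_ext_lambda_product:
  assumes \<beta>: "\<And>x y n. coeff (\<beta> x y) n \<in> fpart parM (parR x + parM y)"
  shows "lambda_product fscale (fpart parR) fscale (fpart parM) (sesqui_ext \<beta>)"
proof -
  interpret R: super_module fscale "fpart parR" by (rule free_super_module)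
  interpret M: super_module fscale "fpart parM" by (rule free_super_module)
  show ?thesis
  proof
    fix a b v w c
    show "sesqui_ext \<beta> (a + b) v = sesqui_ext \<beta> a v + sesqui_ext \<beta> b v"
      by (rule sesqui_ext_add_left)
    show "sesqui_ext \<beta> a (v + w) = sesqui_ext \<beta> a v + sesqui_ext \<beta> a w"
      by (rule sesqui_ext_add_right)
    show "sesqui_ext \<beta> (fscale [:c:] a) v = map_poly (fscale [:c:]) (sesqui_ext \<beta> a v)"
      by (intro sesqui_ext_left additives additive_fscale op_poly_scale additive_minus_lam scale_minus_lam)
    show "sesqui_ext \<beta> a (fscale [:c:] v) = map_poly (fscale [:c:]) (sesqui_ext \<beta> a v)"
      by (intro sesqui_ext_right additives additive_fscale op_poly_scale additive_del_plus_lam scale_del_plus_lam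
          op_poly_commute[symmetric] additive_minus_lam scale_minus_lam scale_scale_commute)
    show "sesqui_ext \<beta> (fscale [:0, 1:] a) v = - pCons 0 (sesqui_ext \<beta> a v)"
      using sesqui_ext_left[of minus_lam "[:0, 1:]" \<beta> a v,
          OF additive_minus_lam op_poly_del[OF additive_minus_lam]]
      by (simp only: minus_lam_def)
    show "sesqui_ext \<beta> a (fscale [:0, 1:] v)
        = map_poly (fscale [:0, 1:]) (sesqui_ext \<beta> a v) + pCons 0 (sesqui_ext \<beta> a v)"
      using sesqui_ext_right[of del_plus_lam "[:0, 1:]" \<beta> a v, OF additive_del_plus_lam
          op_poly_del[OF additive_del_plus_lam]
          op_poly_commute[OF additive_minus_lam additive_del_plus_lam
            minus_lam_del_plus_lam[symmetric] scale_del_plus_lam[symmetric], symmetric]]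
      by (simp only: del_plus_lam_def)
  next
    fix a i v j n
    assume a: "a \<in> fpart parR i" and v: "v \<in> fpart parM j"
    define Q where "Q = {q. \<forall>n. coeff q n \<in> fpart parM (i + j)}"
    have Q0: "0 \<in> Q" by (simp add: Q_def M.subspace_part free.subspace_0)
    have Qadd: "q \<in> Q \<Longrightarrow> r \<in> Q \<Longrightarrow> q + r \<in> Q" for q r
      by (simp add: Q_def M.subspace_part free.subspace_add)
    have Qneg: "q \<in> Q \<Longrightarrow> - q \<in> Q" for q
      by (simp add: Q_def M.subspace_part free.subspace_neg)
    have Qsc: "q \<in> Q \<Longrightarrow> map_poly (fscale r) q \<in> Q" for q r
      by (simp add: Q_def coeff_map_poly M.subspace_part free.subspace_scale)
    have Qp: "q \<in> Q \<Longrightarrow> pCons 0 q \<in> Q" for q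
      using Q0 by (auto simp: Q_def coeff_pCons split: nat.splits)
    have Qop: "op_poly T q w \<in> Q" if "w \<in> Q" "additive T" "\<And>z. z \<in> Q \<Longrightarrow> T z \<in> Q" for T q w
    proof (induction q)
      case 0 show ?case by (simp add: op_poly_0 Q0)
    next
      case (pCons c q)
      show ?case unfolding op_poly_pCons[OF that(2)]
        by (intro Qadd Qsc that(1,3) pCons.IH)
    qed
    have "ext_term \<beta> a v x y \<in> Q" if "x \<in> Poly_Mapping.keys a" "y \<in> Poly_Mapping.keys v" for x y
    proof (intro Qop additive_minus_lam additive_del_plus_lam)
      have "parR x = i" "parM y = j" using that a v by (auto simp: fpart_def)
      then show "\<beta> x y \<in> Q" using \<beta>[of x y] by (simp add: Q_def)
    qed (auto simp: minus_lam_def del_plus_lam_def intro!: Qadd Qneg Qsc Qp)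
    then have "(\<Sum>x\<in>Poly_Mapping.keys a. \<Sum>y\<in>Poly_Mapping.keys v. ext_term \<beta> a v x y) \<in> Q"
      using Q0 Qadd by (intro sum_closed) auto
    then show "coeff (sesqui_ext \<beta> a v) n \<in> fpart parM (i + j)"
      by (simp add: sesqui_ext_def Q_def)
  qed
qed


subsection \<open>Reduction of the axioms to basis elements\<close>

definition good_var :: "('m::ab_group_add poly poly \<Rightarrow> 'm poly poly) \<Rightarrow> bool"
  where "good_var X \<longleftrightarrow> additive X \<and>
    (\<forall>g x. additive g \<longrightarrow> map_poly (map_poly g) (X x) = X (map_poly (map_poly g) x))"

lemma good_var_lam: "good_var lam" and good_var_mu: "good_var mu"
  by (simp_all add: good_var_def additive_lam additive_mu map_poly_lam map_poly_mu additive.zero)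

lemma good_var_plus: "good_var X \<Longrightarrow> good_var Y \<Longrightarrow> good_var (\<lambda>x. X x + Y x)"
  by (simp add: good_var_def additive_plus map_poly_add' additive_map_poly)

lemma at_var_0: "at_var X 0 = 0"
  by (simp add: at_var_def subst_var_0)

lemma at_var_pCons: "additive X \<Longrightarrow> at_var X (pCons c q) = [:[:c:]:] + X (at_var X q)"
  by (simp add: at_var_def subst_var_pCons)

lemma at_var_add: "additive X \<Longrightarrow> at_var X (p + q) = at_var X p + at_var X q"
  by (simp add: additive.add additive_at_var)

lemma at_var_minus: "additive X \<Longrightarrow> at_var X (- p) = - at_var X p"
  by (simp add: additive.minus additive_at_var)

lemma at_var_map_poly:
  assumes "good_var X" "additive g"
  shows "at_var X (map_poly g q) = map_poly (map_poly g) (at_var X q)"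
proof (induction q)
  case 0 show ?case by (simp add: at_var_0)
next
  case (pCons c q)
  then show ?case using assms
    by (simp add: map_poly_pCons additive.zero at_var_pCons good_var_def map_poly_add' additive_map_poly)
qed

lemma (in lambda_product) additive_act:
  "additive (\<lambda>a. act a v)" "additive (act a)" "additive (sM r)"
  by (simp_all add: additive_def add_left add_right M.scale_right_distrib)

locale lambda_pair = B: lambda_product sR pR sR pR brk + A: lambda_product sR pR sM pM act
  for sR :: "complex poly \<Rightarrow> 'r::ab_group_add \<Rightarrow> 'r" and pR :: "bit \<Rightarrow> 'r set"
    and brk :: "'r \<Rightarrow> 'r \<Rightarrow> 'r poly"
    and sM :: "complex poly \<Rightarrow> 'm::ab_group_add \<Rightarrow> 'm" and pM :: "bit \<Rightarrow> 'm set"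
    and act :: "'r \<Rightarrow> 'm \<Rightarrow> 'm poly"
begin

abbreviation "sc r \<equiv> map_poly (map_poly (sM r))"

definition nest where "nest X Y a q = subst_var Y (\<lambda>w. at_var X (act a w)) q"
definition left where "left v q = subst_var lam (\<lambda>w. at_var (\<lambda>x. lam x + mu x) (act w v)) q"

lemma additive_sc: "additive (sc r)"
  by (simp add: additive_map_poly A.additive_act)

lemma additive_inner: "good_var X \<Longrightarrow> additive (\<lambda>w. at_var X (act a w))"
  "good_var X \<Longrightarrow> additive (\<lambda>w. at_var X (act w v))"
  by (simp_all add: additive_def at_var_add good_var_def A.add_left A.add_right)

lemma gsc: "good_var X \<Longrightarrow> sc r (X x) = X (sc r x)"
  using A.additive_act by (simp add: good_var_def)

context
  fixes X Y :: "'m poly poly \<Rightarrow> 'm poly poly"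
  assumes X: "good_var X" and Y: "good_var Y" and XY: "\<And>x. X (Y x) = Y (X x)"
begin

lemma addX: "additive X" and addY: "additive Y"
  using X Y by (simp_all add: good_var_def)

lemma nest_add_right: "nest X Y a (p + q) = nest X Y a p + nest X Y a q"
  unfolding nest_def by (intro subst_var_add addY additive_inner X)

lemma nest_minus: "nest X Y a (- q) = - nest X Y a q"
  unfolding nest_def by (intro subst_var_minus addY additive_inner X)

lemma nest_0: "nest X Y a 0 = 0"
  using nest_add_right[of a 0 0] by simp

lemma nest_pCons: "nest X Y a (pCons w q) = at_var X (act a w) + Y (nest X Y a q)"
  unfolding nest_def by (intro subst_var_pCons addY additive.zero additive_inner X)

lemma nest_add_left: "nest X Y (a + b) q = nest X Y a q + nest X Y b q"
  by (induction q) (simp_all add: nest_0 nest_pCons A.add_left at_var_add addX additive.add[OF addY])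

lemma nest_scale_left: "nest X Y (sR [:c:] a) q = sc [:c:] (nest X Y a q)"
  by (induction q) (simp_all add: nest_0 nest_pCons A.scale_left at_var_map_poly X A.additive_act
      additive.add[OF additive_sc] gsc Y)

lemma nest_del_left: "nest X Y (sR [:0, 1:] a) q = - X (nest X Y a q)"
  by (induction q) (simp_all add: nest_0 nest_pCons A.del_left at_var_minus at_var_pCons addX
      additive.add[OF addX] additive.zero[OF addX] additive.minus[OF addX]
      additive.minus[OF addY] XY)

lemma nest_scale_right: "nest X Y a (map_poly (sM [:c:]) q) = sc [:c:] (nest X Y a q)"
  by (induction q) (simp_all add: map_poly_pCons nest_0 nest_pCons A.scale_right at_var_map_poly X
      A.additive_act additive.add[OF additive_sc] gsc Y)

lemma nest_del_right:
  "nest X Y a (map_poly (sM [:0, 1:]) q) = sc [:0, 1:] (nest X Y a q) + X (nest X Y a q)"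
  by (induction q) (simp_all add: map_poly_pCons nest_0 nest_pCons A.del_right at_var_map_poly X
      A.additive_act additive.add[OF additive_sc] gsc Y at_var_add at_var_pCons addX
      additive.add[OF addX] additive.add[OF addY] additive.zero[OF addX] XY)

end

lemma LM: "lam (mu x) = mu (lam x)" "mu (lam x) = lam (mu x)"
  by (simp_all add: lam_mu)

lemmas nest_lm = nest_add_right[OF good_var_lam good_var_mu LM(1)] nest_add_left[OF good_var_lam good_var_mu LM(1)]
  nest_minus[OF good_var_lam good_var_mu LM(1)] nest_0[OF good_var_lam good_var_mu LM(1)]
  nest_pCons[OF good_var_lam good_var_mu LM(1)]
  nest_scale_left[OF good_var_lam good_var_mu LM(1)] nest_scale_right[OF good_var_lam good_var_mu LM(1)]
  nest_del_left[OF good_var_lam good_var_mu LM(1)] nest_del_right[OF good_var_lam good_var_mu LM(1)]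

lemmas nest_ml = nest_add_right[OF good_var_mu good_var_lam LM(2)] nest_add_left[OF good_var_mu good_var_lam LM(2)]
  nest_minus[OF good_var_mu good_var_lam LM(2)] nest_0[OF good_var_mu good_var_lam LM(2)]
  nest_pCons[OF good_var_mu good_var_lam LM(2)]
  nest_scale_left[OF good_var_mu good_var_lam LM(2)] nest_scale_right[OF good_var_mu good_var_lam LM(2)]
  nest_del_left[OF good_var_mu good_var_lam LM(2)] nest_del_right[OF good_var_mu good_var_lam LM(2)]

lemma good_var_lm: "good_var (\<lambda>x. lam x + mu x)"
  by (intro good_var_plus good_var_lam good_var_mu)

lemma add_lm: "additive (\<lambda>x. lam x + mu x)"
  by (intro additive_plus additive_lam additive_mu)

lemma left_add: "left v (p + q) = left v p + left v q"
  unfolding left_def by (intro subst_var_add additive_lam additive_inner good_var_lm)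

lemma left_minus: "left v (- q) = - left v q"
  unfolding left_def by (intro subst_var_minus additive_lam additive_inner good_var_lm)

lemma left_0: "left v 0 = 0"
  using left_add[of v 0 0] by simp

lemma left_pCons: "left v (pCons w q) = at_var (\<lambda>x. lam x + mu x) (act w v) + lam (left v q)"
  unfolding left_def by (intro subst_var_pCons additive_lam additive.zero additive_inner good_var_lm)

lemma left_add_arg: "left (v + w) q = left v q + left w q"
  by (induction q) (simp_all add: left_0 left_pCons A.add_right at_var_add add_lm
      additive.add[OF additive_lam])

lemma left_scale: "left v (map_poly (sR [:c:]) q) = sc [:c:] (left v q)"
  by (induction q) (simp_all add: map_poly_pCons left_0 left_pCons A.scale_left at_var_map_poly
      good_var_lm A.additive_act additive.add[OF additive_sc] gsc good_var_lam)

lemma left_scale_arg: "left (sM [:c:] v) q = sc [:c:] (left v q)"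
  by (induction q) (simp_all add: left_0 left_pCons A.scale_right at_var_map_poly
      good_var_lm A.additive_act additive.add[OF additive_sc] gsc good_var_lam)

lemma left_del: "left v (map_poly (sR [:0, 1:]) q) = - (lam (left v q) + mu (left v q))"
  by (induction q) (simp_all add: map_poly_pCons left_0 left_pCons A.del_left at_var_minus
      at_var_pCons add_lm additive.add[OF additive_lam] additive.add[OF additive_mu]
      additive.minus[OF additive_lam] additive.minus[OF additive_mu] additive.diff[OF additive_lam]
      additive.zero[OF additive_lam] additive.zero[OF additive_mu] lam_mu)

lemma left_del_arg: "left (sM [:0, 1:] v) q = sc [:0, 1:] (left v q) + lam (left v q) + mu (left v q)"
  by (induction q) (simp_all add: left_0 left_pCons A.del_right at_var_map_poly good_var_lm
      A.additive_act additive.add[OF additive_sc] gsc good_var_lam at_var_add at_var_pCons add_lm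
      additive.add[OF additive_lam] additive.add[OF additive_mu] additive.zero[OF additive_lam]
      additive.zero[OF additive_mu] lam_mu)

definition jac where "jac i j a b v \<longleftrightarrow>
  left v (brk a b) = nest lam mu a (act b v) - koszul i j (nest mu lam b (act a v))"

lemma jac_add: "jac i j a b v \<Longrightarrow> jac i j a' b v \<Longrightarrow> jac i j (a + a') b v"
  "jac i j a b v \<Longrightarrow> jac i j a b' v \<Longrightarrow> jac i j a (b + b') v"
  "jac i j a b v \<Longrightarrow> jac i j a b v' \<Longrightarrow> jac i j a b (v + v')"
  by (simp_all add: jac_def B.add_left B.add_right A.add_left A.add_right left_add left_add_arg
      nest_lm nest_ml koszul_def)

lemma jac_scale: "jac i j a b v \<Longrightarrow> jac i j (sR [:c:] a) b v"
  "jac i j a b v \<Longrightarrow> jac i j a (sR [:c:] b) v"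
  "jac i j a b v \<Longrightarrow> jac i j a b (sM [:c:] v)"
  by (auto simp add: jac_def B.scale_left B.scale_right A.scale_left A.scale_right left_scale
      left_scale_arg nest_lm nest_ml koszul_def additive.minus[OF additive_sc]
      additive.add[OF additive_sc] additive.diff[OF additive_sc])

lemma pCons_nest: "nest lam mu a (pCons 0 q) = mu (nest lam mu a q)"
  "nest mu lam a (pCons 0 q) = lam (nest mu lam a q)"
  "left v (pCons 0 r) = lam (left v r)"
  by (simp_all add: nest_lm nest_ml left_pCons additive.zero[OF A.additive_act(2)]
      additive.zero[OF A.additive_act(1)] at_var_0)

lemma jac_del: "jac i j a b v \<Longrightarrow> jac i j (sR [:0, 1:] a) b v"
  "jac i j a b v \<Longrightarrow> jac i j a (sR [:0, 1:] b) v"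
  "jac i j a b v \<Longrightarrow> jac i j a b (sM [:0, 1:] v)"
  by (auto simp add: jac_def B.del_left B.del_right A.del_left A.del_right left_del
      left_minus left_add left_del_arg nest_lm(1-3) nest_lm(6-) nest_ml(1-3) nest_ml(6-)
      pCons_nest koszul_def additive.minus[OF additive_sc]
      additive.add[OF additive_sc] additive.diff[OF additive_sc]
      additive.minus[OF additive_lam] additive.add[OF additive_lam] additive.diff[OF additive_lam]
      additive.minus[OF additive_mu] additive.add[OF additive_mu] additive.diff[OF additive_mu])

lemma jac_zero: "jac i j 0 b v" "jac i j a 0 v" "jac i j a b 0"
  using jac_scale[of i j 0 0 0 0]
  by (simp_all add: jac_def additive.zero[OF A.additive_act(1)] additive.zero[OF A.additive_act(2)]
      additive.zero[OF B.additive_act(1)] additive.zero[OF B.additive_act(2)] left_0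
      nest_lm(4) nest_ml(4) koszul_def)
   (use left_add_arg[of 0 0] nest_lm(2)[of 0 0] nest_ml(2)[of 0 0] in simp_all)

end

lemma free_jac:
  assumes "lambda_pair fscale (fpart parR) brk fscale (fpart parM) act"
    and gen: "\<And>x y z. lambda_pair.jac brk act (parR x) (parR y) (gen x) (gen y) (gen z)"
    and a: "a \<in> fpart parR i" and b: "b \<in> fpart parR j"
  shows "lambda_pair.jac brk act i j a b v"
proof -
  interpret lambda_pair fscale "fpart parR" brk fscale "fpart parM" act by fact
  have g: "jac i j (gen x) (gen y) v" if "parR x = i" "parR y = j" for x y v
  proof -
    have *: "v \<in> fpart (\<lambda>_. 0) 0" by (simp add: fpart_def)
    from * show ?thesis
      by (induction rule: fpart_induct) (use gen that in \<open>auto intro: jac_add jac_scale jac_del jac_zero\<close>)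
  qed
  have "jac i j (gen x) b v" if "parR x = i" for x
    using b by (induction rule: fpart_induct)
      (use g that in \<open>auto intro: jac_add jac_scale jac_del jac_zero\<close>)
  note g' = this
  from a show ?thesis
    by (induction rule: fpart_induct) (use g' in \<open>auto intro: jac_add jac_scale jac_del jac_zero\<close>)
qed

definition flip_lam :: "('b \<Rightarrow>\<^sub>0 complex poly) poly \<Rightarrow> ('b \<Rightarrow>\<^sub>0 complex poly) poly"
  where "flip_lam = subst_var (\<lambda>x. - pCons 0 x - map_poly (fscale [:0, 1:]) x) (\<lambda>c. [:c:])"

lemma additive_flip_op: "additive (\<lambda>x. - pCons 0 x - map_poly (fscale [:0, 1:]) x)"
  by (simp add: additive_def map_poly_add'[OF additive_fscale])

lemma additive_flip_lam: "additive flip_lam"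
  unfolding flip_lam_def by (intro additive_subst_var additive_flip_op additive_const1)

lemma flip_lam_pCons:
  "flip_lam (pCons c q) = [:c:] - pCons 0 (flip_lam q) - map_poly (fscale [:0, 1:]) (flip_lam q)"
  unfolding flip_lam_def by (subst subst_var_pCons[OF additive_flip_op]) auto

lemma flip_lam_fscale: "flip_lam (map_poly (fscale r) q) = map_poly (fscale r) (flip_lam q)"
proof (induction q)
  case 0 show ?case by (simp add: additive.zero[OF additive_flip_lam])
next
  case (pCons c q)
  show ?case
    by (simp add: map_poly_pCons flip_lam_pCons pCons.IH fscale_poly_mult mult.commute map_poly_fscale_minus
        additive.diff[OF additive_map_poly[OF additive_fscale]])
qed

lemma free_skew:
  assumes "lambda_product fscale (fpart par) fscale (fpart par) brk"
    and gen: "\<And>x y. brk (gen x) (gen y) = - koszul (par x) (par y) (flip_lam (brk (gen y) (gen x)))"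
    and a: "a \<in> fpart par i" and b: "b \<in> fpart par j"
  shows "brk a b = - koszul i j (flip_lam (brk b a))"
proof -
  interpret lambda_product fscale "fpart par" fscale "fpart par" brk by fact
  let ?P = "\<lambda>a b. brk a b = - koszul i j (flip_lam (brk b a))"
  note z = additive.zero[OF additive_act(1)] additive.zero[OF additive_act(2)]
    additive.zero[OF additive_flip_lam]
  note simps = add_left add_right scale_left scale_right del_left del_right koszul_def
    additive.add[OF additive_flip_lam] additive.minus[OF additive_flip_lam]
    flip_lam_fscale flip_lam_pCons map_poly_fscale_minus
  have add: "?P a b \<Longrightarrow> ?P a' b \<Longrightarrow> ?P (a + a') b" "?P a b \<Longrightarrow> ?P a b' \<Longrightarrow> ?P a (b + b')" for a a' b b'
    by (simp_all add: simps)
  have scale: "?P a b \<Longrightarrow> ?P (fscale [:c:] a) b" "?P a b \<Longrightarrow> ?P a (fscale [:c:] b)" for a b c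
    by (auto simp: simps)
  have del: "?P a b \<Longrightarrow> ?P (fscale [:0, 1:] a) b" "?P a b \<Longrightarrow> ?P a (fscale [:0, 1:] b)" for a b
    by (auto simp: simps)
  have zero: "?P 0 b" "?P a 0" for a b
    by (simp_all add: z koszul_def)
  have "?P (gen x) b" if "par x = i" for x
    using b by (induction rule: fpart_induct) (use add scale del zero gen[of x] that in auto)
  note g = this
  from a show ?thesis
    by (induction rule: fpart_induct) (use g add scale del zero in auto)
qed

subsection \<open>The identities on basis elements\<close>

lemma fscale_gen: "fscale r (gen x) = Poly_Mapping.single x r"
  by (simp add: gen_def fscale_single)

lemma lin_eq: "lin a b c x = [:Poly_Mapping.single x [:c, a:], Poly_Mapping.single x [:b:]:]"
  by (simp add: lin_def fscale_gen)

lemma fscale_linear: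
  "fscale [:c, a:] x = fscale [:c:] x + fscale [:a:] (fscale [:0, 1:] x)"
  by (simp flip: free.scale_left_distrib)

lemma K_table_parity: "coeff (K_table p x y) n \<in> fpart K_par (K_par x + K_par y)"
  by (cases x; cases y)
     (auto simp: lin_eq coeff_pCons fpart_iff lookup_single lookup_add when_def split: nat.splits)

lemma K_lambda_product: "lambda_product fscale K_part fscale K_part (K_brk p)"
  unfolding K_brk_def by (rule sesqui_ext_lambda_product) (rule K_table_parity)

lemma K_brk_gen: "K_brk p (gen x) (gen y) = K_table p x y"
  by (simp add: K_brk_def sesqui_ext_gen)

lemma flip_lam_lin: "flip_lam (lin a b c x) = lin (a - b) (- b) c x"
  by (simp add: lin_eq flip_lam_pCons additive.zero[OF additive_flip_lam] map_poly_pCons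
      fscale_single single_add[symmetric] single_uminus[symmetric] single_diff[symmetric])

lemma lin_minus: "- lin a b c x = lin (- a) (- b) (- c) x"
  by (simp add: lin_eq single_uminus[symmetric])

lemma K_skew:
  "K_table p x y = - koszul (K_par x) (K_par y) (flip_lam (K_table p y x))"
  by (cases x; cases y)
     (auto simp: flip_lam_lin koszul_def additive.zero[OF additive_flip_lam]
       additive.add[OF additive_flip_lam] lin_minus add.commute algebra_simps
       intro!: arg_cong[of _ _ "\<lambda>a. lin a _ _ _"])

context
  fixes brk :: "('b \<Rightarrow>\<^sub>0 complex poly) \<Rightarrow> ('b \<Rightarrow>\<^sub>0 complex poly) \<Rightarrow> ('b \<Rightarrow>\<^sub>0 complex poly) poly"
    and act :: "('b \<Rightarrow>\<^sub>0 complex poly) \<Rightarrow> ('c \<Rightarrow>\<^sub>0 complex poly) \<Rightarrow> ('c \<Rightarrow>\<^sub>0 complex poly) poly"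
    and parR parM
  assumes pair: "lambda_pair fscale (fpart parR) brk fscale (fpart parM) act"
begin

interpretation lambda_pair fscale "fpart parR" brk fscale "fpart parM" act by (fact pair)

lemma at_var_lin:
  assumes "good_var X"
  shows "at_var X (lin a b c x) = [:[:Poly_Mapping.single x [:c, a:]:]:] + X [:[:Poly_Mapping.single x [:b:]:]:]"
  using assms by (simp add: lin_eq at_var_pCons good_var_def at_var_0 additive.zero)

lemma at_var_lams:
  "at_var lam (lin a b c x) = [:[:Poly_Mapping.single x [:c, a:], Poly_Mapping.single x [:b:]:]:]"
  "at_var mu (lin a b c x) = [:[:Poly_Mapping.single x [:c, a:]:], [:Poly_Mapping.single x [:b:]:]:]"
  "at_var (\<lambda>x. lam x + mu x) (lin a b c x) =
     [:[:Poly_Mapping.single x [:c, a:], Poly_Mapping.single x [:b:]:], [:Poly_Mapping.single x [:b:]:]:]"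
  by (simp_all add: at_var_lin good_var_lam good_var_mu good_var_lm) (simp_all add: lam_def mu_def map_poly_pCons)


lemma at_var_act:
  assumes X: "good_var X"
  shows "at_var X (act a (u + v)) = at_var X (act a u) + at_var X (act a v)"
    and "at_var X (act a (fscale [:c:] v)) = sc [:c:] (at_var X (act a v))"
    and "at_var X (act a (fscale [:0, 1:] v)) = sc [:0, 1:] (at_var X (act a v)) + X (at_var X (act a v))"
    and "at_var X (act (a + b) v) = at_var X (act a v) + at_var X (act b v)"
    and "at_var X (act (fscale [:c:] a) v) = sc [:c:] (at_var X (act a v))"
    and "at_var X (act (fscale [:0, 1:] a) v) = - X (at_var X (act a v))"
proof -
  have aX: "additive X" using X by (simp add: good_var_def)
  have p: "at_var X (pCons 0 q) = X (at_var X q)" for q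
    by (simp add: at_var_pCons aX)
  show "at_var X (act a (u + v)) = at_var X (act a u) + at_var X (act a v)"
    "at_var X (act (a + b) v) = at_var X (act a v) + at_var X (act b v)"
    by (simp_all only: A.add_left A.add_right at_var_add[OF aX])
  show "at_var X (act a (fscale [:c:] v)) = sc [:c:] (at_var X (act a v))"
    "at_var X (act (fscale [:c:] a) v) = sc [:c:] (at_var X (act a v))"
    by (simp_all only: A.scale_left A.scale_right at_var_map_poly[OF X additive_fscale])
  show "at_var X (act a (fscale [:0, 1:] v)) = sc [:0, 1:] (at_var X (act a v)) + X (at_var X (act a v))"
    by (simp only: A.del_right at_var_add[OF aX] at_var_map_poly[OF X additive_fscale] p)
  show "at_var X (act (fscale [:0, 1:] a) v) = - X (at_var X (act a v))"
    by (simp only: A.del_left at_var_minus[OF aX] p)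
qed

lemma nest_lin_lm:
  "nest lam mu a (lin A B C x) = (let Z = at_var lam (act a (gen x)) in
     sc [:C:] Z + sc [:A:] (sc [:0, 1:] Z + lam Z) + sc [:B:] (mu Z))"
  by (simp only: lin_def nest_lm(4,5) fscale_linear[of C A "gen x"] at_var_act[OF good_var_lam] Let_def
      additive.zero[OF additive_mu] add_0_right gsc[OF good_var_mu])

lemma nest_lin_ml:
  "nest mu lam a (lin A B C x) = (let Z = at_var mu (act a (gen x)) in
     sc [:C:] Z + sc [:A:] (sc [:0, 1:] Z + mu Z) + sc [:B:] (lam Z))"
  by (simp only: lin_def nest_ml(4,5) fscale_linear[of C A "gen x"] at_var_act[OF good_var_mu] Let_def
      additive.zero[OF additive_lam] add_0_right gsc[OF good_var_lam])

lemma left_lin: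
  "left v (lin A B C x) = (let Z = at_var (\<lambda>x. lam x + mu x) (act (gen x) v) in
     sc [:C:] Z + sc [:A:] (- (lam Z + mu Z)) + sc [:B:] (lam Z))"
  by (simp only: lin_def left_0 left_pCons fscale_linear[of C A "gen x"] at_var_act[OF good_var_lm] Let_def
      additive.zero[OF additive_lam] add_0_right gsc[OF good_var_lam])

end

lemma K_lambda_pair: "lambda_pair fscale K_part (K_brk p) fscale K_part (K_brk p)"
  by (simp add: lambda_pair_def K_lambda_product)

lemmas K_nest = nest_lin_lm[OF K_lambda_pair] nest_lin_ml[OF K_lambda_pair]
  left_lin[OF K_lambda_pair]

interpretation K: lambda_pair fscale K_part "K_brk p" fscale K_part "K_brk p" for p
  by (rule K_lambda_pair)

lemmas K_simps = K.jac_def K_brk_gen K_table.simps K_par.simps K_nest koszul_def Let_def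
  at_var_lams[OF K_lambda_pair] K.nest_lm(1,4) K.nest_ml(1,4) K.left_add K.left_0
  at_var_add[OF additive_lam] at_var_add[OF additive_mu] at_var_add[OF K.add_lm] at_var_0
  bit.distinct simp_thms if_False if_True

lemmas lookup_simps = lookup_add lookup_minus lookup_uminus lookup_single lookup_fscale when_def

lemmas tri_simps = lam_def mu_def map_poly_pCons fscale_single free.scale_right_distrib
  free.scale_minus_right poly_mapping_eq_iff fun_eq_iff lookup_simps add.assoc add.left_commute

lemma K_jac: "K.jac p (K_par x) (K_par y) (gen x) (gen y) (gen z)"
  by (cases x; cases y; cases z; simp only: K_simps; (simp add: tri_simps)?;
      (simp add: lookup_simps algebra_simps)?; (simp add: numeral_poly)?;
      (simp add: field_simps)?)

theorem lie_conformal_superalgebra_K: "lie_conformal_superalgebra fscale K_part (K_brk p)"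
proof -
  interpret lambda_product fscale K_part fscale K_part "K_brk p" by (rule K_lambda_product)
  show ?thesis
  proof
    fix a b c i j assume ab: "a \<in> K_part i" "b \<in> K_part j"
    show "K_brk p a b = - koszul i j (subst_var (\<lambda>x. - pCons 0 x - map_poly (fscale [:0, 1:]) x)
        (\<lambda>c. [:c:]) (K_brk p b a))"
      using free_skew[OF K_lambda_product _ ab] K_skew unfolding flip_lam_def K_brk_gen by blast
    have "K.jac p i j a b c"
      by (rule free_jac[OF K_lambda_pair K_jac ab])
    then show "subst_var mu (\<lambda>w. at_var lam (K_brk p a w)) (K_brk p b c) =
        subst_var lam (\<lambda>w. at_var (\<lambda>x. lam x + mu x) (K_brk p w c)) (K_brk p a b)
        + koszul i j (subst_var lam (\<lambda>w. at_var mu (K_brk p b w)) (K_brk p a c))"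
      by (simp add: K.jac_def K.nest_def K.left_def)
  qed
qed


section \<open>\<open>V\<^sup>(\<^sup>1\<^sup>)\<close> and \<open>V\<^sup>(\<^sup>2\<^sup>)\<close> are conformal modules\<close>

lemma K_moduleI:
  assumes V: "\<And>x y n. coeff (\<beta> x y) n \<in> fpart par (K_par x + par y)"
    and jac: "\<And>x y z. lambda_pair.jac (K_brk p) (sesqui_ext \<beta>) (K_par x) (K_par y) (gen x) (gen y) (gen z)"
  shows "conformal_module fscale K_part (K_brk p) fscale (fpart par) (sesqui_ext \<beta>)"
proof -
  have pair: "lambda_pair fscale K_part (K_brk p) fscale (fpart par) (sesqui_ext \<beta>)"
    by (simp add: lambda_pair_def K_lambda_product sesqui_ext_lambda_product[OF V])
  interpret lambda_pair fscale K_part "K_brk p" fscale "fpart par" "sesqui_ext \<beta>" by (rule pair)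
  interpret lie_conformal_superalgebra fscale K_part "K_brk p" by (rule lie_conformal_superalgebra_K)
  show ?thesis
  proof
    fix a b v i j assume ab: "a \<in> K_part i" "b \<in> K_part j"
    have "jac i j a b v"
      by (rule free_jac[OF pair jac ab])
    then show "subst_var lam (\<lambda>w. at_var (\<lambda>x. lam x + mu x) (sesqui_ext \<beta> w v)) (K_brk p a b) =
        subst_var mu (\<lambda>w. at_var lam (sesqui_ext \<beta> a w)) (sesqui_ext \<beta> b v)
        - koszul i j (subst_var lam (\<lambda>w. at_var mu (sesqui_ext \<beta> b w)) (sesqui_ext \<beta> a v))"
      by (simp add: jac_def nest_def left_def)
  qed
qed

lemma K_cases:
  obtains "x = K_L 0" | "x = K_J 0" | "x = K_Gp 0" | "x = K_Gm 0"
    | i where "x = K_L (Suc i)" | i where "x = K_J (Suc i)"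
    | i where "x = K_Gp (Suc i)" | i where "x = K_Gm (Suc i)"
  by (cases x; metis not0_implies_Suc)

lemma V1_parity: "coeff (V1_table p s \<Delta> \<alpha> x y) n \<in> fpart (\<lambda>y. y) (K_par x + y)"
  by (cases x rule: K_cases; cases y)
     (auto simp: lin_eq coeff_pCons fpart_iff lookup_single when_def split: nat.splits)

lemma V2_parity: "coeff (V2_table p s \<Delta> \<alpha> x y) n \<in> fpart (\<lambda>y. y) (K_par x + y)"
  by (cases x rule: K_cases; cases y)
     (auto simp: lin_eq coeff_pCons fpart_iff lookup_single when_def split: nat.splits)

lemma V_lambda_pair:
  "lambda_pair fscale K_part (K_brk p) fscale V_part (sesqui_ext (V1_table p s \<Delta> \<alpha>))"
  "lambda_pair fscale K_part (K_brk p) fscale V_part (sesqui_ext (V2_table p s \<Delta> \<alpha>))"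
  by (intro lambda_pair.intro K_lambda_product sesqui_ext_lambda_product V1_parity V2_parity)+

interpretation V1: lambda_pair fscale K_part "K_brk p" fscale V_part "sesqui_ext (V1_table p s \<Delta> \<alpha>)"
  for p s \<Delta> \<alpha> by (rule V_lambda_pair)
interpretation V2: lambda_pair fscale K_part "K_brk p" fscale V_part "sesqui_ext (V2_table p s \<Delta> \<alpha>)"
  for p s \<Delta> \<alpha> by (rule V_lambda_pair)

lemmas V_simps = sesqui_ext_gen K_brk_gen K_table.simps K_par.simps koszul_def Let_def
  V1_table.simps V2_table.simps
  at_var_add[OF additive_lam] at_var_add[OF additive_mu] at_var_add[OF K.add_lm] at_var_0
  bit.distinct simp_thms if_False if_True add_Suc add_Suc_right add_0_left add_0_right

lemmas V1_simps = V_simps V1.jac_def nest_lin_lm[OF V_lambda_pair(1)]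
  nest_lin_ml[OF V_lambda_pair(1)] left_lin[OF V_lambda_pair(1)] at_var_lams[OF V_lambda_pair(1)]
  V1.nest_lm(1,4) V1.nest_ml(1,4) V1.left_add V1.left_0

lemmas V2_simps = V_simps V2.jac_def nest_lin_lm[OF V_lambda_pair(2)]
  nest_lin_ml[OF V_lambda_pair(2)] left_lin[OF V_lambda_pair(2)] at_var_lams[OF V_lambda_pair(2)]
  V2.nest_lm(1,4) V2.nest_ml(1,4) V2.left_add V2.left_0

lemma lookup_double:
  fixes a :: "'b::monoid_add \<Rightarrow>\<^sub>0 complex poly"
  shows "Poly_Mapping.lookup (2 * a) k = 2 * Poly_Mapping.lookup a k"
  by (simp only: mult_2 lookup_add)

lemma V1_jac: "V1.jac (s * s) s \<Delta> \<alpha> (K_par x) (K_par y) (gen x) (gen y) (gen z)"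
  by (cases x rule: K_cases; cases y rule: K_cases; cases z; simp only: V1_simps;
      (simp add: tri_simps)?; (simp add: lookup_double lookup_simps algebra_simps)?; (simp add: numeral_poly)?;
      (simp add: field_simps)?)

lemma V2_jac: "V2.jac (s * s) s \<Delta> \<alpha> (K_par x) (K_par y) (gen x) (gen y) (gen z)"
  by (cases x rule: K_cases; cases y rule: K_cases; cases z; simp only: V2_simps;
      (simp add: tri_simps)?; (simp add: lookup_double lookup_simps algebra_simps)?; (simp add: numeral_poly)?;
      (simp add: field_simps)?)

theorem conformal_module_V:
  assumes "s ^ 2 = p"
  shows "conformal_module fscale K_part (K_brk p) fscale V_part (V1_act p s \<Delta> \<alpha>)"
    and "conformal_module fscale K_part (K_brk p) fscale V_part (V2_act p s \<Delta> \<alpha>)"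
proof -
  have p: "p = s * s" using assms by (simp add: power2_eq_square)
  show "conformal_module fscale K_part (K_brk p) fscale V_part (V1_act p s \<Delta> \<alpha>)"
    unfolding p V1_act_def by (intro K_moduleI V1_parity V1_jac)
  show "conformal_module fscale K_part (K_brk p) fscale V_part (V2_act p s \<Delta> \<alpha>)"
    unfolding p V2_act_def by (intro K_moduleI V2_parity V2_jac)
qed

end

theory Submission
  imports Defs
begin

text \<open>
  Let \<open>u\<close>, \<open>w\<close> be the basis of \<open>M\<close>, so that every basis element of \<open>\<KK>(p)\<close> acts through polynomials in
  \<open>\<partial>\<close> and \<open>\<lambda>\<close>.  Setting \<open>\<lambda> = \<mu>\<close> in \<open>[G\<^sub>0\<^sup>+ \<^sub>\<lambda> G\<^sub>0\<^sup>+] = 0\<close> shows that \<open>G\<^sub>0\<^sup>+\<close> kills \<open>u\<close> or \<open>w\<close>, and likewise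
  \<open>G\<^sub>0\<^sup>-\<close>.  If both kill the same vector, \<open>[G\<^sub>0\<^sup>+ \<^sub>\<lambda> G\<^sub>0\<^sup>-]\<close> acts as zero, hence so does \<open>L\<^sub>0\<close>, and then everything.
  Otherwise, up to exchanging \<open>u\<close> and \<open>w\<close>, \<open>G\<^sub>i\<^sup>+ u = f\<^sub>i(\<partial>, \<lambda>) w\<close> and \<open>G\<^sub>i\<^sup>- w = g\<^sub>i(\<partial>, \<lambda>) u\<close>.
  Let \<open>c\<^sub>i\<close>, \<open>d\<^sub>i\<close> be the values at \<open>\<lambda> = 0\<close> of the action of \<open>J\<^sub>i\<close> on \<open>u\<close>, \<open>w\<close>, and \<open>a\<^sub>i\<close>, \<open>b\<^sub>i\<close> those of \<open>L\<^sub>i\<close>.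
  Taking \<open>\<lambda> = 0\<close> in \<open>[J\<^sub>i \<^sub>\<lambda> G\<^sub>0\<^sup>\<plusminus>]\<close> and \<open>\<mu> = - \<lambda>\<close> in \<open>[G\<^sub>0\<^sup>+ \<^sub>\<lambda> G\<^sub>i\<^sup>-]\<close> gives, for \<open>y = x + \<lambda>\<close>,
  \<open>f\<^sub>0(x, \<lambda>) g\<^sub>0(y, -\<lambda>) (d\<^sub>i(x) - c\<^sub>i(y)) = 2(i + p)\<lambda> c\<^sub>i(y) + 2 a\<^sub>i(y) = 2(i + p)\<lambda> d\<^sub>i(x) + 2 b\<^sub>i(x)\<close>.
  For \<open>i = 0\<close> one has \<open>d\<^sub>0(x) - c\<^sub>0(y) = 1\<close>, and so \<open>f\<^sub>0(x, \<lambda>) g\<^sub>0(y, -\<lambda>) = 2p(x + \<kappa>\<lambda> + \<alpha>)\<close>; for \<open>i > 0\<close> comparing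
  coefficients forces \<open>d\<^sub>i(x) = c\<^sub>i(y)\<close>, so that \<open>f\<^sub>i = g\<^sub>i = 0\<close> and all elements of index \<open>i\<close> act as zero.
  One of the two factors \<open>f\<^sub>0\<close>, \<open>g\<^sub>0\<close> is constant: the first case is \<open>V\<^sup>(\<^sup>1\<^sup>)\<close>, the second \<open>V\<^sup>(\<^sup>2\<^sup>)\<close>.
\<close>

section \<open>Polynomial functions of two variables\<close>

text \<open>
  This is all that is used of polynomiality in two variables: products of such functions vanish only
  if a factor does, as one sees on the line through two points where the factors are nonzero.
\<close>
definition poly_on_lines :: "(complex \<Rightarrow> complex \<Rightarrow> complex) \<Rightarrow> bool"
  where "poly_on_lines F \<longleftrightarrow> (\<forall>a b c d. \<exists>q. \<forall>t. F (a + b * t) (c + d * t) = poly q t)"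

lemma poly_on_lines_affine: "poly_on_lines (\<lambda>x y. a * x + b * y + c)"
  unfolding poly_on_lines_def
proof (intro allI)
  fix u v w z
  show "\<exists>q. \<forall>t. a * (u + v * t) + b * (w + z * t) + c = poly q t"
    by (rule exI[of _ "[:a * u + b * w + c, a * v + b * z:]"]) (simp add: algebra_simps)
qed

lemma poly_on_lines_poly1: "poly_on_lines (\<lambda>x y. poly q x)"
  unfolding poly_on_lines_def
proof (intro allI)
  fix a b c d
  show "\<exists>r. \<forall>t. poly q (a + b * t) = poly r t"
    by (rule exI[of _ "pcompose q [:a, b:]"]) (simp add: poly_pcompose mult.commute)
qed

lemma poly_on_lines_add:
  assumes "poly_on_lines F" "poly_on_lines G"
  shows "poly_on_lines (\<lambda>x y. F x y + G x y)"
  using assms unfolding poly_on_lines_def by (metis poly_add)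

lemma poly_on_lines_diff:
  assumes "poly_on_lines F" "poly_on_lines G"
  shows "poly_on_lines (\<lambda>x y. F x y - G x y)"
  using assms unfolding poly_on_lines_def by (metis poly_diff)

lemma poly_on_lines_mult:
  assumes "poly_on_lines F" "poly_on_lines G"
  shows "poly_on_lines (\<lambda>x y. F x y * G x y)"
  using assms unfolding poly_on_lines_def by (metis poly_mult)

lemma poly_on_lines_compose:
  assumes "poly_on_lines F"
  shows "poly_on_lines (\<lambda>x y. F (a * x + b * y + c) (a' * x + b' * y + c'))"
  unfolding poly_on_lines_def
proof (intro allI)
  fix u v w z
  obtain q where "\<And>t. F ((a * u + b * w + c) + (a * v + b * z) * t)
      ((a' * u + b' * w + c') + (a' * v + b' * z) * t) = poly q t"
    using assms unfolding poly_on_lines_def by blast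
  then show "\<exists>q. \<forall>t. F (a * (u + v * t) + b * (w + z * t) + c) (a' * (u + v * t) + b' * (w + z * t) + c') = poly q t"
    by (intro exI[of _ q]) (simp add: algebra_simps)
qed

lemma poly_on_lines_restrict:
  assumes "poly_on_lines F"
  obtains q where "\<And>t. F (a + b * t) (c + d * t) = poly q t"
  using assms unfolding poly_on_lines_def by blast

lemma poly_on_lines_mult_eq_0:
  assumes "poly_on_lines F" "poly_on_lines G" and FG: "\<And>x y. F x y * G x y = 0"
  shows "(\<forall>x y. F x y = 0) \<or> (\<forall>x y. G x y = 0)"
proof (rule ccontr)
  assume "\<not> ?thesis"
  then obtain x0 y0 x1 y1 where ne: "F x0 y0 \<noteq> 0" "G x1 y1 \<noteq> 0" by blast
  obtain q where q: "\<And>t. F (x0 + (x1 - x0) * t) (y0 + (y1 - y0) * t) = poly q t"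
    using poly_on_lines_restrict[OF assms(1)] by metis
  obtain r where r: "\<And>t. G (x0 + (x1 - x0) * t) (y0 + (y1 - y0) * t) = poly r t"
    using poly_on_lines_restrict[OF assms(2)] by metis
  have "poly (q * r) t = 0" for t using FG by (simp flip: q r)
  then have "q * r = 0" using poly_all_0_iff_0 by blast
  moreover have "q \<noteq> 0" using q[of 0] ne by auto
  moreover have "r \<noteq> 0" using r[of 1] ne by auto
  ultimately show False by simp
qed

text \<open>The form \<open>x + k * y + c\<close> is irreducible. Along a line with
  \<open>x + k * y\<close> constant the product is constant, and nonzero for all but one such line,
  so both factors are constant there. Hence they depend on \<open>x + k * y\<close> alone, and a
  degree count in that one variable finishes.\<close>

lemma poly_on_lines_mult_eq_affine:
  assumes F: "poly_on_lines F" and H: "poly_on_lines H"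
    and FH: "\<And>x y. F x y * H x y = m * (x + k * y + c)" and m: "m \<noteq> 0"
  obtains r where "r \<noteq> 0" "\<And>x y. F x y = r" | r where "r \<noteq> 0" "\<And>x y. H x y = r"
proof -
  have const: "K x y = K (x + k * y) 0"
    if K: "poly_on_lines K" and K': "poly_on_lines K'" and KK: "\<And>x y. K x y * K' x y = m * (x + k * y + c)"
    for K K' x y
  proof -
    have step: "K x y = K (x + k * y) 0" if ne: "x + k * y + c \<noteq> 0" for x y
    proof -
      \<comment> \<open>The direction \<open>(- k, 1)\<close> keeps the affine form fixed;
        \<open>t = y\<close> is the given point and \<open>t = 0\<close> the point
        \<open>(x + k * y, 0)\<close>.\<close>
      obtain q where q: "\<And>t. K ((x + k * y) + (- k) * t) (0 + 1 * t) = poly q t"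
        using poly_on_lines_restrict[OF K] by metis
      obtain r where r: "\<And>t. K' ((x + k * y) + (- k) * t) (0 + 1 * t) = poly r t"
        using poly_on_lines_restrict[OF K'] by metis
      have "poly (q * r) t = poly [:m * (x + k * y + c):] t" for t
        using KK by (simp flip: q r)
      then have qr: "q * r = [:m * (x + k * y + c):]" by (intro poly_ext) 
      then have "q \<noteq> 0" "r \<noteq> 0" using ne m by auto
      with qr have "degree q = 0" using degree_mult_eq[of q r] by simp
      then obtain z where "q = [:z:]" by (meson degree_eq_zeroE)
      then have "poly q 0 = poly q y" by simp
      then show ?thesis by (simp flip: q)
    qed
    \<comment> \<open>The exceptional line \<open>x + k * y + c = 0\<close> is dealt with by
      multiplying the defect \<open>D\<close> by the form that vanishes on it.\<close>
    define D where "D x y = K x y - K (x + k * y) 0" for x y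
    have "poly_on_lines (\<lambda>x y. K x y - K (1 * x + k * y + 0) (0 * x + 0 * y + 0))"
      by (intro poly_on_lines_diff K poly_on_lines_compose)
    then have D: "poly_on_lines D" by (simp add: D_def[abs_def])
    have "(1 * x + k * y + c) * D x y = 0" for x y
      using step[of x y] by (auto simp: D_def)
    from poly_on_lines_mult_eq_0[OF poly_on_lines_affine D this]
    show ?thesis
    proof
      assume *: "\<forall>x y. 1 * x + k * y + c = 0"
      from *[rule_format, of "- c" 0] *[rule_format, of "1 - c" 0] show ?thesis by simp
    qed (simp add: D_def)
  qed
  note F0 = const[OF F H FH]
  have H0: "H x y = H (x + k * y) 0" for x y
    by (rule const[OF H F]) (simp add: FH mult.commute)
  obtain q where q: "\<And>t. F (0 + 1 * t) (0 + 0 * t) = poly q t"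
    using poly_on_lines_restrict[OF F] by metis
  obtain r where r: "\<And>t. H (0 + 1 * t) (0 + 0 * t) = poly r t"
    using poly_on_lines_restrict[OF H] by metis
  have "poly (q * r) t = poly [:m * c, m:] t" for t
    using FH by (simp add: algebra_simps flip: q r)
  then have qr: "q * r = [:m * c, m:]" by (intro poly_ext)
  then have ne: "q \<noteq> 0" "r \<noteq> 0" using m by auto
  with qr m have "degree q + degree r = 1" using degree_mult_eq[of q r] by simp
  then consider "degree q = 0" | "degree r = 0" by linarith
  then show thesis
  proof cases
    case 1
    then obtain z where "q = [:z:]" by (meson degree_eq_zeroE)
    with q ne F0 show thesis by (intro that(1)[of z]) auto
  next
    case 2
    then obtain z where "r = [:z:]" by (meson degree_eq_zeroE)
    with r ne H0 show thesis by (intro that(2)[of z]) auto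
  qed
qed


section \<open>The coefficients of a rank (1+1) action\<close>

declare add_bit_eq_xor [simp del] \<comment> \<open>it turns \<open>j + 1\<close> into \<^const>\<open>of_bool\<close> terms\<close>

lemma bit_add_self [simp]: "i + i = 0" "i + j + j = i" "i + (i + j) = j" for i j :: bit
  by (cases i; cases j; simp)+

definition V_eval :: "bit \<Rightarrow> complex \<Rightarrow> complex \<Rightarrow> V_elem poly \<Rightarrow> complex"
  where "V_eval k x l q = poly (map_poly (\<lambda>v. poly (Poly_Mapping.lookup v k) x) q) l"

lemma V_eval_lin: "V_eval k x l (lin a b c z) = (if k = z then a * x + b * l + c else 0)"
  by (simp add: V_eval_def lin_eq map_poly_pCons lookup_single algebra_simps)

lemma V_eval_0: "V_eval k x l 0 = 0"
  by (simp add: V_eval_def)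

text \<open>
  \<open>t X j x l\<close> is the value at \<open>\<partial> = x\<close>, \<open>\<lambda> = l\<close> of the polynomial by which \<open>X \<^sub>\<lambda> \<cdot>\<close> sends the basis
  vector of parity \<open>j\<close> to a multiple of the one of parity \<open>j + K_par X\<close>.  The equations are
  instances of the module Jacobi identity; \<open>L0\<close> is the one for \<open>[L\<^sub>0 \<^sub>\<lambda> X]\<close> at \<open>\<lambda> = 0\<close>.
\<close>
locale K_action_coefficients =
  fixes p :: complex and t :: "K_basis \<Rightarrow> bit \<Rightarrow> complex \<Rightarrow> complex \<Rightarrow> complex"
  assumes p: "p \<noteq> 0"
    and poly: "poly_on_lines (t X j)"
    and L0: "- p * m * t X j x m = t X j x m * (t (K_L 0) (j + K_par X) x 0 - t (K_L 0) j (x + m) 0)"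
    and JGp: "t (K_Gp (i + k)) j x (l + m) =
      t (K_J i) (j + 1) x l * t (K_Gp k) j (x + l) m - t (K_Gp k) j x m * t (K_J i) j (x + m) l"
    and JGm: "- t (K_Gm (i + k)) j x (l + m) =
      t (K_J i) (j + 1) x l * t (K_Gm k) j (x + l) m - t (K_Gm k) j x m * t (K_J i) j (x + m) l"
    and GpGp: "t (K_Gp i) (j + 1) x l * t (K_Gp k) j (x + l) m +
      t (K_Gp k) (j + 1) x m * t (K_Gp i) j (x + m) l = 0"
    and GmGm: "t (K_Gm i) (j + 1) x l * t (K_Gm k) j (x + l) m +
      t (K_Gm k) (j + 1) x m * t (K_Gm i) j (x + m) l = 0"
    and GpGm: "(2 * (of_nat i + of_nat k + p) * l - (2 * of_nat i + p) * (l + m)) * t (K_J (i + k)) j x (l + m)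
        + 2 * t (K_L (i + k)) j x (l + m) =
      t (K_Gp i) (j + 1) x l * t (K_Gm k) j (x + l) m + t (K_Gm k) (j + 1) x m * t (K_Gp i) j (x + m) l"
begin

lemma eq_0_if_mult_nonzero:
  assumes "poly_on_lines F" "poly_on_lines G" "\<And>x y. F x y * G x y = 0" "F a b \<noteq> 0"
  shows "G x y = 0"
  using poly_on_lines_mult_eq_0[OF assms(1-3)] assms(4) by blast

text \<open>At \<open>l = m\<close> the two terms of \<open>GpGp\<close> coincide, so their common
  value is zero. The shear from \<open>(x, l)\<close> to \<open>(x + l, l)\<close> in one factor is
  invertible; its coefficients are spelled out to match
  \<open>poly_on_lines_compose\<close>.\<close>

lemma Gp_eq_0: "(\<forall>x l. t (K_Gp 0) j x l = 0) \<or> (\<forall>x l. t (K_Gp 0) (j + 1) x l = 0)"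
proof -
  have P: "poly_on_lines (\<lambda>x l. t (K_Gp 0) j (1 * x + 1 * l + 0) (0 * x + 1 * l + 0))"
    by (intro poly_on_lines_compose poly)
  have "t (K_Gp 0) j (1 * x + 1 * l + 0) (0 * x + 1 * l + 0) * t (K_Gp 0) (j + 1) x l = 0" for x l
    using GpGp[of 0 j x l 0 l] by simp
  from poly_on_lines_mult_eq_0[OF P poly this]
  show ?thesis
  proof
    assume *: "\<forall>x l. t (K_Gp 0) j (1 * x + 1 * l + 0) (0 * x + 1 * l + 0) = 0"
    have "t (K_Gp 0) j x l = 0" for x l using *[rule_format, of "x - l" l] by simp
    then show ?thesis by blast
  qed simp
qed

lemma Gm_eq_0: "(\<forall>x l. t (K_Gm 0) j x l = 0) \<or> (\<forall>x l. t (K_Gm 0) (j + 1) x l = 0)"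
proof -
  have P: "poly_on_lines (\<lambda>x l. t (K_Gm 0) j (1 * x + 1 * l + 0) (0 * x + 1 * l + 0))"
    by (intro poly_on_lines_compose poly)
  have "t (K_Gm 0) j (1 * x + 1 * l + 0) (0 * x + 1 * l + 0) * t (K_Gm 0) (j + 1) x l = 0" for x l
    using GmGm[of 0 j x l 0 l] by simp
  from poly_on_lines_mult_eq_0[OF P poly this]
  show ?thesis
  proof
    assume *: "\<forall>x l. t (K_Gm 0) j (1 * x + 1 * l + 0) (0 * x + 1 * l + 0) = 0"
    have "t (K_Gm 0) j x l = 0" for x l using *[rule_format, of "x - l" l] by simp
    then show ?thesis by blast
  qed simp
qed

text \<open>The \<open>J\<close> term of \<open>GpGm\<close> at index 0 has coefficient
  \<open>p * (l - m)\<close>. Setting \<open>l = m\<close> removes it and gives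
  \<open>L_0 = 0\<close>; then \<open>L0\<close> says that \<open>p * m\<close> times any
  coefficient vanishes.\<close>

lemma trivial_if_GpGm_0:
  assumes "\<And>j x l m. t (K_Gp 0) (j + 1) x l * t (K_Gm 0) j (x + l) m +
    t (K_Gm 0) (j + 1) x m * t (K_Gp 0) j (x + m) l = 0"
  shows "t X j x l = 0"
proof -
  have *: "p * (l - m) * t (K_J 0) j x (l + m) + 2 * t (K_L 0) j x (l + m) = 0" for j x l m
    using GpGm[of 0 0 l m j x] assms[of j x l m] by (simp add: algebra_simps)
  have "t (K_L 0) j x l = 0" for j x l
    using *[of "l / 2" "l / 2" j x] by simp
  with L0[of l X j x] have "p * l * t X j x l = 0" for X j x l
    using L0[of l X j x] by simp
  then have **: "(0 * x + 1 * l + 0) * t X j x l = 0" for x l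
    using p by simp
  show ?thesis
    by (rule eq_0_if_mult_nonzero[OF poly_on_lines_affine poly **, of 0 1]) simp
qed

end

section \<open>The case where \<open>Gp 0\<close> maps parity \<open>j\<close> to \<open>j'\<close>
  and \<open>Gm 0\<close> maps back\<close>

locale oriented_K_action = K_action_coefficients +
  fixes j j' :: bit
  assumes shift: "j + 1 = j'" "j' + 1 = j"
    and Gp0: "t (K_Gp 0) j' x l = 0" and Gm0: "t (K_Gm 0) j x l = 0"
    and nontrivial: "\<exists>X k x l. t X k x l \<noteq> 0"
begin

abbreviation "f i \<equiv> t (K_Gp i) j"
abbreviation "g i \<equiv> t (K_Gm i) j'"
abbreviation "C i x \<equiv> t (K_J i) j x 0"
abbreviation "D i x \<equiv> t (K_J i) j' x 0"

text \<open>If one of them vanished, \<open>Gp 0\<close> or \<open>Gm 0\<close> would kill both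
  basis vectors, and \<open>trivial_if_GpGm_0\<close> would contradict nontriviality.\<close>

lemma f_nonzero: "\<exists>x l. f 0 x l \<noteq> 0" and g_nonzero: "\<exists>x l. g 0 x l \<noteq> 0"
proof -
  obtain X k x l where ne: "t X k x l \<noteq> 0" using nontrivial by blast
  have jj: "k = j \<or> k = j'" for k using shift by (cases k; cases j; auto)
  have "\<not> (\<forall>x l. f 0 x l = 0)"
  proof
    assume "\<forall>x l. f 0 x l = 0"
    with Gp0 have "t (K_Gp 0) k x l = 0" for k x l using jj[of k] by metis
    then have "t X k x l = 0" by (intro trivial_if_GpGm_0) simp
    with ne show False by simp
  qed
  moreover have "\<not> (\<forall>x l. g 0 x l = 0)"
  proof
    assume "\<forall>x l. g 0 x l = 0"
    with Gm0 have "t (K_Gm 0) k x l = 0" for k x l using jj[of k] by metis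
    then have "t X k x l = 0" by (intro trivial_if_GpGm_0) simp
    with ne show False by simp
  qed
  ultimately show "\<exists>x l. f 0 x l \<noteq> 0" "\<exists>x l. g 0 x l \<noteq> 0" by blast+
qed

text \<open>This is \<open>JGp\<close> at \<open>k = 0\<close>, \<open>l = 0\<close>. It reduces the
  vanishing of \<open>f i\<close>, and likewise of \<open>g i\<close>, to that of a difference of
  \<open>D i\<close> and \<open>C i\<close>.\<close>

lemma Gp_from_J: "f i x m = f 0 x m * (D i x - C i (x + m))"
  using JGp[of i 0 j x 0 m, unfolded shift] by (simp add: algebra_simps)

lemma Gm_from_J: "g i x m = g 0 x m * (D i (x + m) - C i x)"
  using JGm[of i 0 j' x 0 m, unfolded shift] by (simp add: algebra_simps)

text \<open>At index 0, cancelling \<open>f 0\<close> from \<open>Gp_from_J\<close> leaves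
  \<open>D 0 x - C 0 (x + m) = 1\<close>. The two arguments are independent, so both functions are
  constant.\<close>

lemma J0: "C 0 x = C 0 0" "D 0 x = C 0 0 + 1"
proof -
  obtain a b where ab: "f 0 a b \<noteq> 0" using f_nonzero by blast
  have "poly_on_lines (\<lambda>x m. t (K_J 0) j' (1 * x + 0 * m + 0) (0 * x + 0 * m + 0)
      - t (K_J 0) j (1 * x + 1 * m + 0) (0 * x + 0 * m + 0) - (0 * x + 0 * m + 1))"
    by (intro poly_on_lines_diff poly_on_lines_compose poly poly_on_lines_affine)
  then have P: "poly_on_lines (\<lambda>x m. D 0 x - C 0 (x + m) - 1)" by simp
  have *: "D 0 x - C 0 (x + m) - 1 = 0" for x m
    by (rule eq_0_if_mult_nonzero[OF poly P _ ab]) (use Gp_from_J[of 0] in \<open>simp add: algebra_simps\<close>)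
  show D: "D 0 x = C 0 0 + 1" for x using *[of x "- x"] by (simp add: algebra_simps)
  show "C 0 x = C 0 0" using *[of 0 x] D[of 0] by simp
qed

text \<open>One of the two index-0 operators kills one summand of each anticommutator by
  \<open>Gp0\<close> or \<open>Gm0\<close>, so a single product remains.\<close>

lemma GpGm_u: "((2 * of_nat k + p) * l - p * m) * t (K_J k) j x (l + m) + 2 * t (K_L k) j x (l + m)
    = f 0 (x + m) l * g k x m"
  and GmGp_u: "(p * l - (2 * of_nat k + p) * m) * t (K_J k) j x (l + m) + 2 * t (K_L k) j x (l + m)
    = f k (x + m) l * g 0 x m"
  and GpGm_w: "((2 * of_nat k + p) * l - p * m) * t (K_J k) j' x (l + m) + 2 * t (K_L k) j' x (l + m)
    = f 0 x l * g k (x + l) m"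
  and GmGp_w: "(p * l - (2 * of_nat k + p) * m) * t (K_J k) j' x (l + m) + 2 * t (K_L k) j' x (l + m)
    = f k x l * g 0 (x + l) m"
  using GpGm[of 0 k l m j x, unfolded shift] GpGm[of k 0 l m j x, unfolded shift]
    GpGm[of 0 k l m j' x, unfolded shift] GpGm[of k 0 l m j' x, unfolded shift]
  by (simp_all add: Gp0 Gm0 algebra_simps)

text \<open>At \<open>m = - l\<close> only values of \<open>J_0\<close> and \<open>L_0\<close> at
  \<lambda> = 0 remain. The product is computed through either basis vector; comparing the two
  results at \<open>x = 0\<close> shows that \<open>L_0\<close> at \<lambda> = 0 is
  \<open>p * x\<close> plus a constant on parity \<open>j\<close>.\<close>

lemma product_0:
  defines "\<kappa> \<equiv> C 0 0 + 1" and "\<alpha> \<equiv> t (K_L 0) j 0 0 / p"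
  shows "f 0 x l * g 0 (x + l) (- l) = 2 * p * (x + \<kappa> * l + \<alpha>)"
proof -
  have A: "f 0 x l * g 0 (x + l) (- l) = 2 * p * l * C 0 0 + 2 * t (K_L 0) j (x + l) 0" for x l
    using GpGm_u[of 0 l "- l" "x + l"] J0(1)[of "x + l"] by (simp add: algebra_simps)
  have B: "f 0 x l * g 0 (x + l) (- l) = 2 * p * l * (C 0 0 + 1) + 2 * t (K_L 0) j' x 0" for x l
    using GpGm_w[of 0 l "- l" x] J0(2)[of x] by (simp add: algebra_simps)
  have "2 * t (K_L 0) j (0 + x) 0 = 2 * p * x + 2 * t (K_L 0) j 0 0" for x
    using A[of 0 x] B[of 0 x] A[of 0 0] B[of 0 0] by (simp add: algebra_simps)
  from this[of "x + l"] A[of x l] show ?thesis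
    using p by (simp add: \<kappa>_def \<alpha>_def field_simps)
qed

text \<open>With \<open>y = x + l\<close> as an independent variable, \<open>P1\<close> and
  \<open>P2\<close> are functional equations for \<open>C'\<close>, \<open>D'\<close> and
  \<open>A\<close>. If \<open>q = 0\<close>, then \<open>A\<close> is constant and equals an affine
  form times \<open>D' x - C' y\<close>, up to a factor; a zero of the form makes it vanish. If
  \<open>q\<close> is nonzero, \<open>C'\<close> and \<open>D'\<close> turn out affine, and
  comparing coefficients makes them equal constants.\<close>

lemma J_eq:
  assumes i: "i > 0"
  shows "D i x = C i y"
proof -
  define \<kappa> where "\<kappa> = C 0 0 + 1"
  define \<alpha> where "\<alpha> = t (K_L 0) j 0 0 / p"
  define q where "q = 2 * of_nat i + 2 * p"
  define C' where "C' = C i"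
  define D' where "D' = D i"
  define A where "A x = t (K_L i) j x 0" for x
  define A' where "A' x = t (K_L i) j' x 0" for x
  have P1: "2 * p * (x + \<kappa> * (y - x) + \<alpha>) * (D' x - C' y) = q * (y - x) * C' y + 2 * A y" for x y
  proof -
    have "q * (y - x) * C' y + 2 * A y = f 0 x (y - x) * g i y (- (y - x))"
      using GpGm_u[of i "y - x" "x - y" y] by (simp add: q_def C'_def A_def algebra_simps)
    also have "\<dots> = f 0 x (y - x) * g 0 (x + (y - x)) (- (y - x)) * (D' x - C' y)"
      using Gm_from_J[of i y "x - y"] by (simp add: C'_def D'_def)
    also have "\<dots> = 2 * p * (x + \<kappa> * (y - x) + \<alpha>) * (D' x - C' y)"
      by (simp only: product_0 \<kappa>_def \<alpha>_def)
    finally show ?thesis ..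
  qed
  have P2: "q * (y - x) * C' y + 2 * A y = q * (y - x) * D' x + 2 * A' x" for x y
  proof -
    have "q * (y - x) * C' y + 2 * A y = f 0 x (y - x) * g i y (- (y - x))"
      using GpGm_u[of i "y - x" "x - y" y] by (simp add: q_def C'_def A_def algebra_simps)
    also have "\<dots> = q * (y - x) * D' x + 2 * A' x"
      using GpGm_w[of i "y - x" "x - y" x] by (simp add: q_def D'_def A'_def algebra_simps)
    finally show ?thesis .
  qed
  have A': "A' x = A x" for x using P2[of x x] by simp
  have S: "q * (y - x) * (D' x - C' y) = 2 * A y - 2 * A x" for x y
    using P2[of y x] A' by (simp add: algebra_simps)
  show ?thesis
  proof (cases "q = 0")
    case True
    have "2 * A y = 2 * A 0" for y using S[of y 0] True by simp
    then have A0: "A y = A 0" for y by (simp only: mult_cancel_left) simp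
    have P: "p * ((1 - \<kappa>) * x + \<kappa> * y + \<alpha>) * (D' x - C' y) = A 0" for x y
    proof -
      have "2 * (p * ((1 - \<kappa>) * x + \<kappa> * y + \<alpha>) * (D' x - C' y)) = 2 * A 0"
        using P1[of x y] True A0[of y] by (simp add: algebra_simps)
      then show ?thesis by (simp only: mult_cancel_left) simp
    qed
    \<comment> \<open>A zero exists because \<open>1 - \<kappa>\<close> and \<open>\<kappa>\<close>
      are not both zero.\<close>
    obtain x0 y0 where "(1 - \<kappa>) * x0 + \<kappa> * y0 + \<alpha> = 0"
    proof (cases "\<kappa> = 0")
      case True show thesis by (rule that[of "- \<alpha>" 0]) (simp add: True)
    next
      case False show thesis by (rule that[of 0 "- \<alpha> / \<kappa>"]) (simp add: False)
    qed
    with P[of x0 y0] have "A 0 = 0" by simp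
    with P p have Z: "((1 - \<kappa>) * x + \<kappa> * y + \<alpha>) * (D' x - C' y) = 0" for x y by simp
    \<comment> \<open>On the diagonal the form is \<open>x + \<alpha>\<close>, which is 1 at this
      point.\<close>
    obtain x1 y1 where ne: "(1 - \<kappa>) * x1 + \<kappa> * y1 + \<alpha> \<noteq> 0"
      by (rule that[of "1 - \<alpha>" "1 - \<alpha>"]) (simp add: algebra_simps)
    have "poly_on_lines (\<lambda>x y. t (K_J i) j' (1 * x + 0 * y + 0) (0 * x + 0 * y + 0)
        - t (K_J i) j (0 * x + 1 * y + 0) (0 * x + 0 * y + 0))"
      by (intro poly_on_lines_diff poly_on_lines_compose poly)
    then have "poly_on_lines (\<lambda>x y. D' x - C' y)" by (simp add: C'_def D'_def)
    from eq_0_if_mult_nonzero[OF poly_on_lines_affine this Z ne, of x y]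
    show ?thesis by (simp add: C'_def D'_def)
  next
    case False
    \<comment> \<open>The right side of \<open>S\<close> is antisymmetric in \<open>x\<close> and
      \<open>y\<close>, and so is the factor \<open>y - x\<close>.\<close>
    have sym: "D' x - C' y = D' y - C' x" for x y
    proof (cases "x = y")
      case ne: False
      have "q * (y - x) * (D' x - C' y) = q * (y - x) * (D' y - C' x)"
        using S[of y x] S[of x y] by algebra
      then show ?thesis using False ne by simp
    qed simp
    define k where "k = C' 0 + D' 0"
    have D': "D' x = k - C' x" for x using sym[of x 0] by (simp add: k_def algebra_simps)
    define \<gamma> where "\<gamma> = C' 1 - C' 0"
    have S': "q * ((y - x) * (k - C' x - C' y)) = 2 * A y - 2 * A x" for x y
      using S[of y x] D' by (simp add: mult.assoc)
    \<comment> \<open>The increments of \<open>A\<close> from 0 to 1 and from 1 to \<open>x\<close>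
      add up to the one from 0 to \<open>x\<close>; solving for \<open>C' x\<close> gives an affine
      function.\<close>
    have C': "C' x = C' 0 + \<gamma> * x" for x
    proof -
      have "q * ((1 - 0) * (k - C' 0 - C' 1) + (x - 1) * (k - C' 1 - C' x)) = q * ((x - 0) * (k - C' 0 - C' x))"
        using S'[of 1 0] S'[of x 1] S'[of x 0] by (simp only: distrib_left) simp
      then have "q * (C' x - (C' 0 + \<gamma> * x)) = 0" by (simp add: \<gamma>_def algebra_simps)
      then show ?thesis using False by simp
    qed
    define m where "m = k - 2 * C' 0"
    have A: "2 * A y = 2 * A 0 + q * y * (m - \<gamma> * y)" for y
      using S'[of y 0] C'[of y] by (simp add: m_def algebra_simps)
    have Q: "2 * p * (x + \<kappa> * (y - x) + \<alpha>) * (m - \<gamma> * (x + y))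
        = q * (y - x) * (C' 0 + \<gamma> * y) + 2 * A 0 + q * y * (m - \<gamma> * y)" for x y
    proof -
      have "D' x - C' y = m - \<gamma> * (x + y)"
        using C'[of x] C'[of y] by (simp add: D' m_def algebra_simps)
      then have "2 * p * (x + \<kappa> * (y - x) + \<alpha>) * (m - \<gamma> * (x + y)) = q * (y - x) * C' y + 2 * A y"
        using P1[of x y] by simp
      also have "\<dots> = q * (y - x) * (C' 0 + \<gamma> * y) + 2 * A 0 + q * y * (m - \<gamma> * y)"
        by (simp only: A[of y] C'[of y] add.assoc)
      finally show ?thesis .
    qed
    \<comment> \<open>For \<open>y = 0\<close> the right side of \<open>Q\<close> has degree at most
      one in \<open>x\<close>; for \<open>x = 0\<close> its \<open>y^2\<close> terms cancel. So the
      quadratic coefficients on the left vanish.\<close>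
    have "p * ((1 - \<kappa>) * \<gamma>) = 0"
      using Q[of 0 0] Q[of 1 0] Q[of "- 1" 0] by algebra
    moreover have "p * (\<kappa> * \<gamma>) = 0"
      using Q[of 0 0] Q[of 0 1] Q[of 0 "- 1"] by algebra
    ultimately have \<gamma>: "\<gamma> = 0" using p by auto
    \<comment> \<open>On the diagonal \<open>Q\<close> now compares \<open>2 * p * m\<close> with
      \<open>q * m\<close>, and \<open>q - 2 * p = 2 * i\<close>. This is where a positive index
      matters.\<close>
    have "2 * of_nat i * m = 0"
      using Q[of 0 0] Q[of 1 1] \<gamma> q_def by algebra
    then have m: "m = 0" using i by simp
    show ?thesis using C'[of x] C'[of y] D'[of x] m by (simp add: \<gamma> m_def C'_def D'_def)
  qed
qed

text \<open>By \<open>J_eq\<close>, \<open>f i\<close> and \<open>g i\<close> vanish, so both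
  anticommutators with index-0 partners do. Their difference is \<open>2 * i * (l + m)\<close> times
  the \<open>J\<close> coefficient, so \<open>J_i\<close> and then \<open>L_i\<close> vanish. The
  other components of \<open>G_i\<close> are killed by anticommuting with the nonzero
  \<open>f 0\<close> and \<open>g 0\<close>.\<close>

lemma positive_index_0:
  assumes i: "i > 0"
  shows "t (K_L i) k x l = 0" "t (K_J i) k x l = 0" "t (K_Gp i) k x l = 0" "t (K_Gm i) k x l = 0"
proof -
  have jj: "k = j \<or> k = j'" using shift by (cases k; cases j; auto)
  have f: "f i x l = 0" and g: "g i x l = 0" for x l
    using Gp_from_J[of i x l] Gm_from_J[of i x l] J_eq[OF i, of x "x + l"] J_eq[OF i, of "x + l" x] by auto
  have Z: "t (K_J i) k x l = 0 \<and> t (K_L i) k x l = 0"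
    if 1: "\<And>l m x. ((2 * of_nat i + p) * l - p * m) * t (K_J i) k x (l + m) + 2 * t (K_L i) k x (l + m) = 0"
    and 2: "\<And>l m x. (p * l - (2 * of_nat i + p) * m) * t (K_J i) k x (l + m) + 2 * t (K_L i) k x (l + m) = 0"
    for k x l
  proof -
    have *: "(0 * x + 1 * l + 0) * t (K_J i) k x l = 0" for x l
    proof -
      have "2 * of_nat i * l * t (K_J i) k x l = 0"
        using 1[of l 0 x] 2[of l 0 x] unfolding add_0_right by algebra
      then show ?thesis using i by simp
    qed
    have J: "t (K_J i) k x l = 0" for x l
      by (rule eq_0_if_mult_nonzero[OF poly_on_lines_affine poly *, of 0 1]) simp
    with 1[of l 0 x] show ?thesis by simp
  qed
  have "t (K_J i) j x l = 0 \<and> t (K_L i) j x l = 0" for x l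
    by (rule Z; simp only: GpGm_u GmGp_u f g mult_zero_left mult_zero_right)
  moreover have "t (K_J i) j' x l = 0 \<and> t (K_L i) j' x l = 0" for x l
    by (rule Z; simp only: GpGm_w GmGp_w f g mult_zero_left mult_zero_right)
  ultimately show "t (K_L i) k x l = 0" "t (K_J i) k x l = 0" using jj by auto
  obtain a b where "f 0 a b \<noteq> 0" using f_nonzero by blast
  then have f0: "f 0 (a - b + b) b \<noteq> 0" by simp
  obtain c d where "g 0 c d \<noteq> 0" using g_nonzero by blast
  then have g0: "g 0 (c - d + d) d \<noteq> 0" by simp
  have "poly_on_lines (\<lambda>x l. f 0 (1 * x + 1 * l + 0) (0 * x + 1 * l + 0))"
    by (intro poly_on_lines_compose poly)
  then have Pf: "poly_on_lines (\<lambda>x l. f 0 (x + l) l)" by simp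
  have "poly_on_lines (\<lambda>x l. g 0 (1 * x + 1 * l + 0) (0 * x + 1 * l + 0))"
    by (intro poly_on_lines_compose poly)
  then have Pg: "poly_on_lines (\<lambda>x l. g 0 (x + l) l)" by simp
  have "t (K_Gp i) j' x l = 0" for x l
  proof (rule eq_0_if_mult_nonzero[OF Pf poly _ f0])
    show "f 0 (x + l) l * t (K_Gp i) j' x l = 0" for x l
      using GpGp[of 0 j x l i l, unfolded shift] by (auto simp: Gp0)
  qed
  with f show "t (K_Gp i) k x l = 0" using jj by auto
  have "t (K_Gm i) j x l = 0" for x l
  proof (rule eq_0_if_mult_nonzero[OF Pg poly _ g0])
    show "g 0 (x + l) l * t (K_Gm i) j x l = 0" for x l
      using GmGm[of 0 j' x l i l, unfolded shift] by (auto simp: Gm0)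
  qed
  with g show "t (K_Gm i) k x l = 0" using jj by auto
qed

lemma solve_J_L:
  assumes "\<And>l m x. p * (l - m) * t (K_J 0) k x (l + m) + 2 * t (K_L 0) k x (l + m)
    = 2 * p * (x + a * l + b * m + c)"
  shows "t (K_J 0) k x l = a - b" "t (K_L 0) k x l = p * (x + (a + b) / 2 * l + c)"
proof -
  \<comment> \<open>The instances \<open>(l + 1, - 1)\<close> and \<open>(l, 0)\<close> have the
    same sum, so subtracting them isolates the \<open>J\<close> term.\<close>
  have "p * (l + 2) * t (K_J 0) k x l + 2 * t (K_L 0) k x l = 2 * p * (x + a * (l + 1) - b + c)"
    using assms[of "l + 1" "- 1" x] by (simp add: add.commute)
  then have "2 * p * t (K_J 0) k x l = 2 * p * (a - b)"
    using assms[of l 0 x] unfolding add_0_right by algebra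
  then show J: "t (K_J 0) k x l = a - b" using p by simp
  show "t (K_L 0) k x l = p * (x + (a + b) / 2 * l + c)"
    using assms[of l 0 x] by (simp add: J field_simps)
qed

text \<open>The equations say that sending the basis vector of parity \<open>y\<close> in the model
  to \<open>r y\<close> times the one of parity \<open>y + k\<close> intertwines the actions;
  \<open>k\<close> records a parity change.\<close>

theorem classification:
  assumes s: "s ^ 2 = p"
  obtains (V1) k r \<Delta> \<alpha> where "\<And>y. r y \<noteq> 0"
      "\<And>X y x l. r (y + K_par X) * V_eval (y + K_par X) x l (V1_table p s \<Delta> \<alpha> X y) = r y * t X (y + k) x l"
    | (V2) k r \<Delta> \<alpha> where "\<And>y. r y \<noteq> 0"
      "\<And>X y x l. r (y + K_par X) * V_eval (y + K_par X) x l (V2_table p s \<Delta> \<alpha> X y) = r y * t X (y + k) x l"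
proof -
  define \<kappa> where "\<kappa> = C 0 0 + 1"
  define \<alpha> where "\<alpha> = t (K_L 0) j 0 0 / p"
  have p_eq: "p = s * s" using s by (simp add: power2_eq_square)
  have s0: "s \<noteq> 0" using s p by auto
  have prod: "f 0 x l * g 0 (x + l) (- l) = 2 * p * (x + \<kappa> * l + \<alpha>)" for x l
    by (simp only: product_0 \<kappa>_def \<alpha>_def)
  have "poly_on_lines (\<lambda>x l. g 0 (1 * x + 1 * l + 0) (0 * x + (- 1) * l + 0))"
    by (intro poly_on_lines_compose poly)
  then have Pg: "poly_on_lines (\<lambda>x l. g 0 (x + l) (- l))" by simp
  from poly Pg prod show thesis
  proof (rule poly_on_lines_mult_eq_affine)
    show "2 * p \<noteq> 0" using p by simp
  next
    fix r assume r: "r \<noteq> 0" and f: "f 0 x l = r" for x l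
    have g: "g 0 x l = 2 * p / r * (x + (1 - \<kappa>) * l + \<alpha>)" for x l
      using prod[of "x + l" "- l"] r by (simp add: f field_simps)
    have fg: "r * (2 * p / r * z) = 2 * p * z" for z using r by simp
    have "p * (l - m) * t (K_J 0) j x (l + m) + 2 * t (K_L 0) j x (l + m) = 2 * p * (x + 0 * l + (1 - \<kappa>) * m + \<alpha>)"
      for l m x using GpGm_u[of 0 l m x, unfolded f g fg] by (simp add: algebra_simps)
    note u = solve_J_L[OF this]
    have u: "t (K_J 0) j x l = \<kappa> - 1" "t (K_L 0) j x l = p * (x + (1 - \<kappa>) / 2 * l + \<alpha>)" for x l
      using u[of x l] by (simp_all add: field_simps)
    have "p * (l - m) * t (K_J 0) j' x (l + m) + 2 * t (K_L 0) j' x (l + m) = 2 * p * (x + 1 * l + (1 - \<kappa>) * m + \<alpha>)"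
      for l m x using GpGm_w[of 0 l m x, unfolded f g fg] by (simp add: algebra_simps)
    note w = solve_J_L[OF this]
    have w: "t (K_J 0) j' x l = \<kappa>" "t (K_L 0) j' x l = p * (x + (2 - \<kappa>) / 2 * l + \<alpha>)" for x l
      using w[of x l] by (simp_all add: field_simps)
    \<comment> \<open>The odd vector is rescaled so that the constant \<open>r\<close> of
      \<open>f 0\<close> becomes the constant \<open>s\<close> of the table.\<close>
    define \<rho> :: "bit \<Rightarrow> complex" where "\<rho> y = (if y = 0 then 1 else r / s)" for y
    show thesis
    proof (rule V1)
      show "\<rho> y \<noteq> 0" for y using r s0 by (simp add: \<rho>_def)
      show "\<rho> (y + K_par X) * V_eval (y + K_par X) x l (V1_table p s ((1 - \<kappa>) / 2) \<alpha> X y)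
          = \<rho> y * t X (y + j) x l" for X y x l
      proof -
        note shift = shift add.commute[of 1 j, unfolded shift]
        show ?thesis
          by (cases X rule: K_cases; cases y;
              simp add: V_eval_lin V_eval_0 positive_index_0 \<rho>_def f g u w Gp0 Gm0 shift;
              simp add: p_eq s0 r field_simps)
      qed
    qed
  next
    fix r assume r: "r \<noteq> 0" and g': "g 0 (x + l) (- l) = r" for x l
    have g: "g 0 x l = r" for x l using g'[of "x + l" "- l"] by simp
    have f: "f 0 x l = 2 * p / r * (x + \<kappa> * l + \<alpha>)" for x l
      using prod[of x l] r by (simp add: g field_simps)
    have fg: "2 * p / r * z * r = 2 * p * z" for z using r by simp
    have "p * (l - m) * t (K_J 0) j x (l + m) + 2 * t (K_L 0) j x (l + m) = 2 * p * (x + \<kappa> * l + 1 * m + \<alpha>)"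
      for l m x using GpGm_u[of 0 l m x, unfolded f g fg] by (simp add: algebra_simps)
    note u = solve_J_L[OF this]
    have u: "t (K_J 0) j x l = \<kappa> - 1" "t (K_L 0) j x l = p * (x + (\<kappa> + 1) / 2 * l + \<alpha>)" for x l
      using u[of x l] by (simp_all add: field_simps)
    have "p * (l - m) * t (K_J 0) j' x (l + m) + 2 * t (K_L 0) j' x (l + m) = 2 * p * (x + \<kappa> * l + 0 * m + \<alpha>)"
      for l m x using GpGm_w[of 0 l m x, unfolded f g fg] by (simp add: algebra_simps)
    note w = solve_J_L[OF this]
    have w: "t (K_J 0) j' x l = \<kappa>" "t (K_L 0) j' x l = p * (x + \<kappa> / 2 * l + \<alpha>)" for x l
      using w[of x l] by (simp_all add: field_simps)
    define \<rho> :: "bit \<Rightarrow> complex" where "\<rho> y = (if y = 0 then 1 else r / s)" for y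
    show thesis
    proof (rule V2)
      show "\<rho> y \<noteq> 0" for y using r s0 by (simp add: \<rho>_def)
      show "\<rho> (y + K_par X) * V_eval (y + K_par X) x l (V2_table p s (\<kappa> / 2) \<alpha> X y)
          = \<rho> y * t X (y + j') x l" for X y x l
      proof -
        note shift = shift add.commute[of 1 j', unfolded shift]
        show ?thesis
          by (cases X rule: K_cases; cases y;
              simp add: V_eval_lin V_eval_0 positive_index_0 \<rho>_def f g u w Gp0 Gm0 shift;
              simp add: p_eq s0 r field_simps)
      qed
    qed
  qed
qed

end


section \<open>Modules with a homogeneous basis\<close>

locale rank11_pair = lambda_pair sR pR brk sM pM act
  for sR :: "complex poly \<Rightarrow> 'r::ab_group_add \<Rightarrow> 'r" and pR :: "bit \<Rightarrow> 'r set"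
    and brk :: "'r \<Rightarrow> 'r \<Rightarrow> 'r poly"
    and sM :: "complex poly \<Rightarrow> 'm::ab_group_add \<Rightarrow> 'm" and pM :: "bit \<Rightarrow> 'm set"
    and act :: "'r \<Rightarrow> 'm \<Rightarrow> 'm poly" +
  fixes e :: "bit \<Rightarrow> 'm"
  assumes e_span: "v \<in> pM i \<Longrightarrow> \<exists>q. v = sM q (e i)"
    and e_indep: "sM q (e i) = 0 \<Longrightarrow> q = 0"
    and e_part: "e i \<in> pM i"
begin

lemma scale_part: "v \<in> pM i \<Longrightarrow> sM q v \<in> pM i"
  by (rule A.M.subspace_scale[OF A.M.subspace_part])

lemma direct_sum_0:
  assumes "sM q (e 0) + sM r (e 1) = 0"
  shows "q = 0" "r = 0"
proof -
  have "sM q (e 0) = sM (- r) (e 1)"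
    using assms by (simp add: eq_neg_iff_add_eq_0)
  then have "sM q (e 0) \<in> pM 0 \<inter> pM 1"
    using scale_part[OF e_part, of q 0] scale_part[OF e_part, of "- r" 1] by simp
  then have "sM q (e 0) = 0" by (simp add: A.M.part_Int)
  with assms show "q = 0" "r = 0" using e_indep by auto
qed

section \<open>Coordinates and evaluation at complex numbers\<close>

definition coord :: "'m \<Rightarrow> bit \<Rightarrow> complex poly"
  where "coord v = (SOME c. v = sM (c 0) (e 0) + sM (c 1) (e 1))"

lemma coord: "v = sM (coord v 0) (e 0) + sM (coord v 1) (e 1)"
proof -
  obtain y z where yz: "y \<in> pM 0" "z \<in> pM 1" "v = y + z" using A.M.part_sum by blast
  obtain q r where "y = sM q (e 0)" "z = sM r (e 1)" using yz e_span by metis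
  then have "\<exists>c :: bit \<Rightarrow> complex poly. v = sM (c 0) (e 0) + sM (c 1) (e 1)"
    using yz by (intro exI[of _ "\<lambda>i. if i = 0 then q else r"]) simp
  then show ?thesis unfolding coord_def by (rule someI_ex)
qed

lemma coord_eqI:
  assumes "v = sM (c 0) (e 0) + sM (c 1) (e 1)"
  shows "coord v = c"
proof
  fix i
  have "sM (coord v 0 - c 0) (e 0) + sM (coord v 1 - c 1) (e 1) = 0"
    using assms coord[of v] by (simp add: A.M.scale_left_diff_distrib algebra_simps)
  from direct_sum_0[OF this] show "coord v i = c i" by (cases i) auto
qed

lemma coord_add: "coord (v + w) i = coord v i + coord w i"
proof -
  have "coord (v + w) = (\<lambda>i. coord v i + coord w i)"
    by (rule coord_eqI, subst coord[of v], subst coord[of w])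
       (simp add: A.M.scale_left_distrib algebra_simps)
  then show ?thesis by simp
qed

lemma coord_scale: "coord (sM q v) i = q * coord v i"
proof -
  have "coord (sM q v) = (\<lambda>i. q * coord v i)"
    by (rule coord_eqI, subst coord[of v]) (simp add: A.M.scale_right_distrib)
  then show ?thesis by simp
qed

lemma coord_e: "coord (e i) k = (if i = k then 1 else 0)"
proof -
  have "coord (e i) = (\<lambda>k. if i = k then 1 else 0)"
    by (rule coord_eqI) (cases i; simp)
  then show ?thesis by simp
qed

lemma coord_part: "v \<in> pM i \<Longrightarrow> k \<noteq> i \<Longrightarrow> coord v k = 0"
  using e_span[of v i] by (auto simp: coord_scale coord_e)

lemma coord_0: "coord 0 k = 0"
  using coord_add[of 0 0 k] by simp

text \<open>
  The coefficient of \<open>e k\<close> in \<open>q\<close>, evaluated at \<open>\<partial> = x\<close> and \<open>\<lambda> = l\<close> (and \<open>\<mu> = m\<close>).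
\<close>
definition eval1 :: "bit \<Rightarrow> complex \<Rightarrow> complex \<Rightarrow> 'm poly \<Rightarrow> complex"
  where "eval1 k x l q = poly (map_poly (\<lambda>v. poly (coord v k) x) q) l"

definition eval2 :: "bit \<Rightarrow> complex \<Rightarrow> complex \<Rightarrow> complex \<Rightarrow> 'm poly poly \<Rightarrow> complex"
  where "eval2 k x l m q = poly (map_poly (eval1 k x l) q) m"

lemma additive_coord: "additive (\<lambda>v. poly (coord v k) x)"
  by (simp add: additive_def coord_add)

lemma eval1_add: "eval1 k x l (q + r) = eval1 k x l q + eval1 k x l r"
  by (simp add: eval1_def map_poly_add' additive_coord)

lemma additive_eval1: "additive (eval1 k x l)"
  by (simp add: additive_def eval1_add)

lemma eval1_0: "eval1 k x l 0 = 0"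
  by (rule additive.zero[OF additive_eval1])

lemma eval1_minus: "eval1 k x l (- q) = - eval1 k x l q"
  by (rule additive.minus[OF additive_eval1])

lemma eval1_pCons: "eval1 k x l (pCons v q) = poly (coord v k) x + l * eval1 k x l q"
  by (simp add: eval1_def map_poly_pCons coord_0)

lemma eval1_map_poly: "eval1 k x l (map_poly (sM r) q) = poly r x * eval1 k x l q"
  by (induction q) (simp_all add: eval1_0 eval1_pCons map_poly_pCons coord_scale algebra_simps)

lemma eval2_add: "eval2 k x l m (q + r) = eval2 k x l m q + eval2 k x l m r"
  by (simp add: eval2_def map_poly_add' additive_eval1)

lemma additive_eval2: "additive (eval2 k x l m)"
  by (simp add: additive_def eval2_add)

lemma eval2_0: "eval2 k x l m 0 = 0"
  by (rule additive.zero[OF additive_eval2])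

lemma eval2_minus: "eval2 k x l m (- q) = - eval2 k x l m q"
  by (rule additive.minus[OF additive_eval2])

lemma eval2_diff: "eval2 k x l m (q - r) = eval2 k x l m q - eval2 k x l m r"
  by (rule additive.diff[OF additive_eval2])

lemma eval2_pCons: "eval2 k x l m (pCons v q) = eval1 k x l v + m * eval2 k x l m q"
  by (simp add: eval2_def map_poly_pCons eval1_0)

lemma eval2_mu: "eval2 k x l m (mu q) = m * eval2 k x l m q"
  by (simp add: mu_def eval2_pCons eval1_0)

lemma eval2_lam: "eval2 k x l m (lam q) = l * eval2 k x l m q"
  by (induction q) (simp_all add: lam_def map_poly_pCons eval2_0 eval2_pCons eval1_pCons coord_0 algebra_simps)

text \<open>This turns substituting an operator for \<lambda> into substituting a number.\<close>

lemma eval2_at_var: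
  assumes X: "additive X" and Xz: "\<And>q. eval2 k x l m (X q) = z * eval2 k x l m q"
  shows "eval2 k x l m (at_var X q) = eval1 k x z q"
  by (induction q) (simp_all add: at_var_0 at_var_pCons[OF X] eval2_add Xz eval2_pCons eval2_0 eval1_pCons eval1_0)

lemma eval2_at_vars:
  "eval2 k x l m (at_var lam q) = eval1 k x l q"
  "eval2 k x l m (at_var mu q) = eval1 k x m q"
  "eval2 k x l m (at_var (\<lambda>q. lam q + mu q) q) = eval1 k x (l + m) q"
  by (rule eval2_at_var; simp add: additive_lam additive_mu add_lm eval2_add eval2_lam eval2_mu algebra_simps)+

section \<open>Evaluation of actions and of the Jacobi identity\<close>

lemma eval1_act_scale: "eval1 k x l (act a (sM q v)) = poly q (x + l) * eval1 k x l (act a v)"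
proof (induction q)
  case 0 then show ?case by (simp add: additive.zero[OF A.additive_act(2)] eval1_0)
next
  case (pCons c q)
  have *: "sM (pCons c q) v = sM [:c:] v + sM [:0, 1:] (sM q v)"
    by (simp flip: A.M.scale_left_distrib)
  show ?case
    unfolding *
    by (simp add: A.add_right A.scale_right A.del_right eval1_add eval1_map_poly eval1_pCons coord_0
        pCons.IH algebra_simps del: A.M.scale_scale)
qed

lemma eval1_scale_act: "eval1 k x l (act (sR r a) v) = poly r (- l) * eval1 k x l (act a v)"
proof (induction r)
  case 0 then show ?case by (simp add: additive.zero[OF A.additive_act(1)] eval1_0)
next
  case (pCons c r)
  have *: "sR (pCons c r) a = sR [:c:] a + sR [:0, 1:] (sR r a)"
    by (simp flip: B.R.scale_left_distrib)
  show ?case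
    unfolding *
    by (simp add: A.add_left A.scale_left A.del_left eval1_add eval1_minus eval1_map_poly eval1_pCons coord_0
        pCons.IH algebra_simps del: B.R.scale_scale)
qed

lemma eval1_act: "eval1 k x l (act a v) =
    poly (coord v 0) (x + l) * eval1 k x l (act a (e 0)) + poly (coord v 1) (x + l) * eval1 k x l (act a (e 1))"
  by (subst coord[of v]) (simp only: A.add_right eval1_add eval1_act_scale)

text \<open>The coordinates of the inner result pass through the outer action, where
  \<open>\<partial>\<close> becomes \<open>\<partial> + \<lambda>\<close>; hence the argument
  \<open>x + l\<close>.\<close>

lemma eval2_nest_lm: "eval2 k x l m (nest lam mu a q) =
    eval1 0 (x + l) m q * eval1 k x l (act a (e 0)) + eval1 1 (x + l) m q * eval1 k x l (act a (e 1))"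
proof (induction q)
  case 0 then show ?case by (simp add: nest_lm(4) eval2_0 eval1_0)
next
  case (pCons v q)
  then show ?case
    by (simp add: nest_lm(5) eval2_add eval2_mu eval2_at_vars eval1_act[of k x l a v] eval1_pCons algebra_simps)
qed

lemma eval2_nest_ml: "eval2 k x l m (nest mu lam a q) =
    eval1 0 (x + m) l q * eval1 k x m (act a (e 0)) + eval1 1 (x + m) l q * eval1 k x m (act a (e 1))"
proof (induction q)
  case 0 then show ?case by (simp add: nest_ml(4) eval2_0 eval1_0)
next
  case (pCons v q)
  then show ?case
    by (simp add: nest_ml(5) eval2_add eval2_lam eval2_at_vars eval1_act[of k x m a v] eval1_pCons algebra_simps)
qed

lemma eval1_act_parity: "a \<in> pR i \<Longrightarrow> k \<noteq> i + j \<Longrightarrow> eval1 k x l (act a (e j)) = 0"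
proof -
  assume a: "a \<in> pR i" and k: "k \<noteq> i + j"
  have "map_poly (\<lambda>v. poly (coord v k) x) (act a (e j)) = 0"
    by (rule poly_eqI) (simp add: coeff_map_poly coord_0 coord_part[OF A.parity[OF a e_part] k])
  then show ?thesis by (simp add: eval1_def)
qed

text \<open>Complex polynomials are determined by their values, so module identities can be checked
  numerically.\<close>

lemma eval1_inject:
  assumes "\<And>k x l. eval1 k x l q = eval1 k x l r"
  shows "q = r"
proof (rule poly_eqI)
  fix n
  have "coord (coeff q n) k = coord (coeff r n) k" for k
  proof (rule poly_ext)
    fix x
    have "map_poly (\<lambda>v. poly (coord v k) x) q = map_poly (\<lambda>v. poly (coord v k) x) r"
      using assms by (intro poly_ext) (simp add: eval1_def)
    then have "coeff (map_poly (\<lambda>v. poly (coord v k) x) q) n = coeff (map_poly (\<lambda>v. poly (coord v k) x) r) n"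
      by simp
    then show "poly (coord (coeff q n) k) x = poly (coord (coeff r n) k) x"
      by (simp add: coeff_map_poly coord_0)
  qed
  then show "coeff q n = coeff r n" using coord[of "coeff q n"] coord[of "coeff r n"] by simp
qed

lemma poly_on_lines_eval1: "poly_on_lines (\<lambda>x l. eval1 k x l q)"
proof (induction q)
  case 0 then show ?case using poly_on_lines_affine[of 0 0 0] by (simp add: eval1_0)
next
  case (pCons v q)
  have "poly_on_lines (\<lambda>x l. poly (coord v k) x + (0 * x + 1 * l + 0) * eval1 k x l q)"
    by (intro poly_on_lines_add poly_on_lines_mult poly_on_lines_affine poly_on_lines_poly1 pCons.IH)
  then show ?case by (simp add: eval1_pCons)
qed

lemma jac_eval:
  assumes jac: "jac i i' a b (e j)" and a: "a \<in> pR i" and b: "b \<in> pR i'"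
  shows "eval2 (j + i' + i) x l m (left (e j) (brk a b)) =
    eval1 (j + i' + i) x l (act a (e (j + i'))) * eval1 (j + i') (x + l) m (act b (e j))
    - koszul i i' (eval1 (j + i' + i) x m (act b (e (j + i))) * eval1 (j + i) (x + m) l (act a (e j)))"
proof -
  \<comment> \<open>Parity leaves one nonzero summand in each sum over the basis.\<close>
  have split: "eval1 0 y z (act c (e j)) * f 0 + eval1 1 y z (act c (e j)) * f 1
      = f (j + h) * eval1 (j + h) y z (act c (e j))"
    if "c \<in> pR h" for c h y z and f :: "bit \<Rightarrow> complex"
    using eval1_act_parity[OF that, of "j + h + 1" j y z] by (cases j; cases h; simp)
  show ?thesis
    using jac unfolding jac_def
    by (simp add: eval2_diff eval2_minus koszul_def eval2_nest_lm eval2_nest_ml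
        split[OF b, where f = "\<lambda>h. eval1 _ _ _ (act a (e h))"]
        split[OF a, where f = "\<lambda>h. eval1 _ _ _ (act b (e h))"])
qed

end


section \<open>Modules over \<open>\<KK>(p)\<close>\<close>

lemma gen_in_K_part: "gen X \<in> K_part (K_par X)"
  by (simp add: fpart_def gen_def)

lemma lookup_gen: "Poly_Mapping.lookup (gen y) x = (if y = x then 1 else 0)"
  unfolding gen_def lookup_single when_def ..

lemma free_induct [case_names zero add scale del gen]:
  assumes "P 0" "\<And>a b. P a \<Longrightarrow> P b \<Longrightarrow> P (a + b)" "\<And>c a. P a \<Longrightarrow> P (fscale [:c:] a)"
    "\<And>a. P a \<Longrightarrow> P (fscale [:0, 1:] a)" "\<And>x. P (gen x)"
  shows "P a"
proof -
  \<comment> \<open>For the constant parity every element is homogeneous.\<close>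
  have "a \<in> fpart (\<lambda>_. 0) 0" by (simp add: fpart_def)
  then show ?thesis by (induction rule: fpart_induct) (use assms in auto)
qed

locale K_rank11_module = rank11_pair fscale K_part "K_brk p" sM pM act e
  for p :: complex and sM :: "complex poly \<Rightarrow> 'm::ab_group_add \<Rightarrow> 'm" and pM :: "bit \<Rightarrow> 'm set"
    and act :: "K_elem \<Rightarrow> 'm \<Rightarrow> 'm poly" and e :: "bit \<Rightarrow> 'm" +
  assumes p: "p \<noteq> 0"
    and jac: "a \<in> K_part i \<Longrightarrow> b \<in> K_part j \<Longrightarrow> jac i j a b v"
begin

definition t :: "K_basis \<Rightarrow> bit \<Rightarrow> complex \<Rightarrow> complex \<Rightarrow> complex"
  where "t X j x l = eval1 (j + K_par X) x l (act (gen X) (e j))"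

lemma eval1_gen: "eval1 k x l (act (gen X) (e j)) = (if k = j + K_par X then t X j x l else 0)"
  using eval1_act_parity[OF gen_in_K_part] by (auto simp: t_def add.commute)

lemma eval2_left_lin:
  "eval2 k x l m (left v (lin a b c Z)) = (c - a * (l + m) + b * l) * eval1 k x (l + m) (act (gen Z) v)"
  by (simp add: lin_def left_pCons left_0 eval2_add eval2_lam eval2_0 eval2_at_vars eval1_scale_act
      algebra_simps)

lemma jac_gen: "eval2 (j + K_par Y + K_par X) x l m (left (e j) (K_table p X Y)) =
    t X (j + K_par Y) x l * t Y j (x + l) m
    - koszul (K_par X) (K_par Y) (t Y (j + K_par X) x m * t X j (x + m) l)"
  using jac_eval[OF jac[OF gen_in_K_part gen_in_K_part] gen_in_K_part gen_in_K_part, of j Y X x l m]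
  by (simp add: K_brk_gen t_def ac_simps)

lemmas jac_simps = eval2_left_lin eval2_add eval2_0 eval1_gen left_add left_0 koszul_def

sublocale K_action_coefficients p t
proof
  show "p \<noteq> 0" by (rule p)
  show "poly_on_lines (t X j)" for X j
    using poly_on_lines_eval1 by (simp add: t_def[abs_def])
  show "- p * m * t X j x m = t X j x m * (t (K_L 0) (j + K_par X) x 0 - t (K_L 0) j (x + m) 0)" for m X j x
    \<comment> \<open>At \<open>l = 0\<close> only the \<open>\<partial>\<close> part of the bracket
      with \<open>L_0\<close> contributes, and its coefficient is \<open>p\<close> for every
      \<open>X\<close>.\<close>
    using jac_gen[of j X "K_L 0" x 0 m] by (cases X) (simp_all add: jac_simps algebra_simps)
  fix i k j x l m
  show "t (K_Gp (i + k)) j x (l + m) =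
      t (K_J i) (j + 1) x l * t (K_Gp k) j (x + l) m - t (K_Gp k) j x m * t (K_J i) j (x + m) l"
    using jac_gen[of j "K_Gp k" "K_J i" x l m] by (simp add: jac_simps)
  show "- t (K_Gm (i + k)) j x (l + m) =
      t (K_J i) (j + 1) x l * t (K_Gm k) j (x + l) m - t (K_Gm k) j x m * t (K_J i) j (x + m) l"
    using jac_gen[of j "K_Gm k" "K_J i" x l m] by (simp add: jac_simps)
  show "t (K_Gp i) (j + 1) x l * t (K_Gp k) j (x + l) m +
      t (K_Gp k) (j + 1) x m * t (K_Gp i) j (x + m) l = 0"
    using jac_gen[of j "K_Gp k" "K_Gp i" x l m] by (simp add: jac_simps)
  show "t (K_Gm i) (j + 1) x l * t (K_Gm k) j (x + l) m +
      t (K_Gm k) (j + 1) x m * t (K_Gm i) j (x + m) l = 0"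
    using jac_gen[of j "K_Gm k" "K_Gm i" x l m] by (simp add: jac_simps)
  show "(2 * (of_nat i + of_nat k + p) * l - (2 * of_nat i + p) * (l + m)) * t (K_J (i + k)) j x (l + m)
        + 2 * t (K_L (i + k)) j x (l + m) =
      t (K_Gp i) (j + 1) x l * t (K_Gm k) j (x + l) m + t (K_Gm k) (j + 1) x m * t (K_Gp i) j (x + m) l"
    using jac_gen[of j "K_Gm k" "K_Gp i" x l m] by (simp add: jac_simps algebra_simps)
qed

lemma t_nonzero:
  assumes "nontrivial_action act"
  shows "\<exists>X k x l. t X k x l \<noteq> 0"
proof (rule ccontr)
  assume "\<not> ?thesis"
  then have "t X k x l = 0" for X k x l by blast
  then have g: "eval1 k x l (act (gen X) v) = 0" for X k x l v
    by (simp add: eval1_act[of _ _ _ _ v] eval1_gen)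
  have "eval1 k x l (act a v) = 0" for k x l a v
    by (induction a rule: free_induct)
      (simp_all add: g eval1_0 A.add_left eval1_add eval1_scale_act additive.zero[OF A.additive_act(1)])
  then have "act a v = 0" for a v by (intro eval1_inject) (simp add: eval1_0)
  with assms show False by (simp add: nontrivial_action_def)
qed

text \<open>The inverse \<open>h\<close> is built first, sending \<open>gen y\<close> to
  \<open>r y\<close> times \<open>e (y + k)\<close>. It is equivariant on generators by evaluation,
  and everywhere by sesquilinearity. The case \<open>k = 1\<close> is the parity-reversed
  isomorphism.\<close>

lemma conformal_isoI:
  assumes r: "\<And>y. r y \<noteq> 0"
    and \<beta>: "\<And>x y n. coeff (\<beta> x y) n \<in> fpart (\<lambda>y. y) (K_par x + y)"
    and eq: "\<And>X y x l. r (y + K_par X) * V_eval (y + K_par X) x l (\<beta> X y) = r y * t X (y + k) x l"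
  shows "conformal_iso_up_to_parity sM pM act fscale V_part (sesqui_ext \<beta>)"
proof -
  define h :: "V_elem \<Rightarrow> 'm" where "h v = sM (Poly_Mapping.lookup v 0 * [:r 0:]) (e k) + sM (Poly_Mapping.lookup v 1 * [:r 1:]) (e (1 + k))" for v
  have coord_h: "coord (h v) i = Poly_Mapping.lookup v (i + k) * [:r (i + k):]" for v i
    unfolding h_def coord_add coord_scale coord_e by (cases k; cases i; simp)
  have coord_inject: "v = w" if "\<And>i. coord v i = coord w i" for v w
    using coord[of v] coord[of w] that by simp
  have h_add: "h (v + w) = h v + h w" for v w
    by (rule coord_inject) (simp add: coord_h coord_add lookup_add algebra_simps)
  have h_scale: "h (fscale q v) = sM q (h v)" for q v
    by (rule coord_inject) (simp add: coord_h coord_scale lookup_fscale algebra_simps)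
  have h0: "h 0 = 0" using h_add[of 0 0] by simp
  have "inj h"
  proof (rule injI, rule poly_mapping_eqI)
    fix v w i assume "h v = h w"
    then have "coord (h v) (i + k) = coord (h w) (i + k)" by simp
    then show "Poly_Mapping.lookup v i = Poly_Mapping.lookup w i" using r by (simp add: coord_h poly_eq_iff)
  qed
  moreover have "\<exists>v. h v = m" for m
  proof
    define v where "v = Poly_Mapping.single 0 (coord m k * [:1 / r 0:])
      + Poly_Mapping.single (1::bit) (coord m (1 + k) * [:1 / r 1:])"
    have "coord (h v) i = coord m i" for i
      unfolding coord_h v_def lookup_add lookup_single when_def using r
      by (cases k; cases i; simp add: mult.assoc pCons_one)
    then show "h v = m" by (rule coord_inject)
  qed
  ultimately have bij: "bij h" by (metis bijI surjI surj_def)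
  interpret V: lambda_product fscale K_part fscale V_part "sesqui_ext \<beta>"
    by (rule sesqui_ext_lambda_product) (rule \<beta>)
  have eval_h: "eval1 i x l (map_poly h q) = r (i + k) * V_eval (i + k) x l q" for i x l q
    by (induction q) (simp_all add: eval1_0 V_eval_def map_poly_pCons h0 eval1_pCons coord_h algebra_simps)
  have h_gen: "map_poly h (\<beta> X y) = act (gen X) (h (gen y))" for X y
  proof (rule eval1_inject)
    fix i x l
    have hy: "h (gen y) = sM [:r y:] (e (y + k))"
      by (rule coord_inject) (cases k; cases y; simp add: coord_h coord_scale coord_e lookup_gen)
    have V0: "V_eval i x l (\<beta> X y) = 0" if "i \<noteq> y + K_par X" for i
    proof -
      have "Poly_Mapping.lookup (coeff (\<beta> X y) n) i = 0" for n
        using \<beta>[of X y n] that by (simp add: fpart_iff add.commute)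
      then have "map_poly (\<lambda>v. poly (Poly_Mapping.lookup v i) x) (\<beta> X y) = 0"
        by (intro poly_eqI) (simp add: coeff_map_poly)
      then show ?thesis by (simp add: V_eval_def)
    qed
    show "eval1 i x l (map_poly h (\<beta> X y)) = eval1 i x l (act (gen X) (h (gen y)))"
    proof (cases "i + k = y + K_par X")
      case True
      then have "i = y + k + K_par X" by (metis add.assoc add.commute bit_add_self(2))
      with eq[of y X x l] True show ?thesis
        by (simp add: eval_h hy eval1_act_scale eval1_gen)
    next
      case False
      then have "i \<noteq> y + k + K_par X" by (metis add.assoc add.commute bit_add_self(2))
      with False show ?thesis by (simp add: eval_h hy eval1_act_scale eval1_gen V0)
    qed
  qed
  have additive_h: "additive h" by (simp add: additive_def h_add)
  have h_map: "map_poly h (map_poly (fscale q) w) = map_poly (sM q) (map_poly h w)" for q w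
    by (rule poly_eqI) (simp add: coeff_map_poly h0 h_scale)
  have h_p: "map_poly h (pCons 0 w) = pCons 0 (map_poly h w)" for w
    by (simp add: map_poly_pCons h0)
  note h_simps = map_poly_add'[OF additive_h] h_map h_p h_add h_scale
    additive.minus[OF additive_map_poly[OF additive_h]] h0
    A.add_left A.add_right A.scale_left A.scale_right A.del_left A.del_right
    V.add_left V.add_right V.scale_left V.scale_right V.del_left V.del_right
    additive.zero[OF A.additive_act(1)] additive.zero[OF A.additive_act(2)]
    additive.zero[OF V.additive_act(1)] additive.zero[OF V.additive_act(2)]
  have h_act_gen: "map_poly h (sesqui_ext \<beta> (gen X) v) = act (gen X) (h v)" for X v
    by (induction v rule: free_induct) (simp_all add: h_simps h_gen sesqui_ext_gen)
  have h_act: "map_poly h (sesqui_ext \<beta> a v) = act a (h v)" for a v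
    by (induction a rule: free_induct) (simp_all add: h_simps h_act_gen)
  define f where "f = inv h"
  have fh: "f (h v) = v" and hf: "h (f m) = m" for v m
    using bij by (simp_all add: f_def bij_is_inj bij_is_surj surj_f_inv_f)
  have f_part: "f ` pM i = fpart (\<lambda>y. y) (i + k)" for i
  proof -
    have "h v \<in> pM i \<longleftrightarrow> v \<in> fpart (\<lambda>y. y) (i + k)" for v
    proof
      assume "h v \<in> pM i"
      then have "coord (h v) (i + 1) = 0" using coord_part[of "h v" i "i + 1"] by (cases i) simp_all
      then have "Poly_Mapping.lookup v (i + 1 + k) = 0" using r by (simp add: coord_h)
      then show "v \<in> fpart (\<lambda>y. y) (i + k)" by (cases i; cases k; auto simp: fpart_iff)
    next
      assume "v \<in> fpart (\<lambda>y. y) (i + k)"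
      then have "h v = sM (Poly_Mapping.lookup v (i + k) * [:r (i + k):]) (e i)"
        unfolding fpart_iff by (intro coord_inject) (cases i; cases k; auto simp: coord_h coord_scale coord_e)
      then show "h v \<in> pM i" by (simp add: scale_part e_part)
    qed
    then show ?thesis using fh hf by (auto simp: image_iff) (metis hf)+
  qed
  have "module_hom sM fscale f"
  proof (intro module_hom.intro module_hom_axioms.intro)
    show "module sM" by (rule A.M.module_axioms)
    show "module fscale" by (rule free.module_axioms)
    show "f (b1 + b2) = f b1 + f b2" for b1 b2 using fh[of "f b1 + f b2"] by (simp add: h_add hf)
    show "f (sM q b) = fscale q (f b)" for q b using fh[of "fscale q (f b)"] by (simp add: h_scale hf)
  qed
  moreover have "bij f" using bij by (simp add: f_def bij_imp_bij_inv)
  moreover have "sesqui_ext \<beta> a (f v) = map_poly f (act a v)" for a v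
  proof -
    have f0: "f 0 = 0" using fh[of 0] by (simp add: h0)
    have "map_poly f (act a v) = map_poly f (map_poly h (sesqui_ext \<beta> a (f v)))" by (simp add: h_act hf)
    also have "\<dots> = sesqui_ext \<beta> a (f v)" by (rule poly_eqI) (simp add: coeff_map_poly f0 h0 fh)
    finally show ?thesis ..
  qed
  moreover have "(\<forall>i. f ` pM i = fpart (\<lambda>y. y) i) \<or> (\<forall>i. f ` pM i = reversed (fpart (\<lambda>y. y)) i)"
    by (cases k) (simp_all add: f_part reversed_def)
  ultimately show ?thesis
    unfolding conformal_iso_up_to_parity_def conformal_iso_def by blast
qed

theorem conformal_iso_V:
  assumes s: "s ^ 2 = p" and nontrivial: "nontrivial_action act"
  shows "\<exists>\<Delta> \<alpha>. conformal_iso_up_to_parity sM pM act fscale V_part (V1_act p s \<Delta> \<alpha>) \<or>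
               conformal_iso_up_to_parity sM pM act fscale V_part (V2_act p s \<Delta> \<alpha>)"
proof -
  have oriented: ?thesis
    if Gp0: "\<And>x l. t (K_Gp 0) (j + 1) x l = 0" and Gm0: "\<And>x l. t (K_Gm 0) j x l = 0" for j
  proof -
    interpret oriented_K_action p t j "j + 1"
      by standard (use Gp0 Gm0 t_nonzero[OF nontrivial] in simp_all)
    from s show ?thesis
    proof (cases rule: classification)
      case (V1 k r \<Delta> \<alpha>)
      from conformal_isoI[OF V1(1) V1_parity V1(2)] show ?thesis unfolding V1_act_def by blast
    next
      case (V2 k r \<Delta> \<alpha>)
      from conformal_isoI[OF V2(1) V2_parity V2(2)] show ?thesis unfolding V2_act_def by blast
    qed
  qed
  \<comment> \<open>The first two cases are the two orientations; in the third, every product in the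
    anticommutator has a factor acting on parity \<open>k\<close>, hence zero.\<close>
  consider "\<forall>x l. t (K_Gp 0) 1 x l = 0" "\<forall>x l. t (K_Gm 0) 0 x l = 0"
    | "\<forall>x l. t (K_Gp 0) 0 x l = 0" "\<forall>x l. t (K_Gm 0) 1 x l = 0"
    | k where "\<forall>x l. t (K_Gp 0) k x l = 0" "\<forall>x l. t (K_Gm 0) k x l = 0"
    using Gp_eq_0[of 0] Gm_eq_0[of 0] by fastforce
  then show ?thesis
  proof cases
    case 1 then show ?thesis by (intro oriented[of 0]) simp_all
  next
    case 2 then show ?thesis by (intro oriented[of 1]) simp_all
  next
    case (3 k)
    have "t (K_Gp 0) (j + 1) x l * t (K_Gm 0) j (x + l) m +
      t (K_Gm 0) (j + 1) x m * t (K_Gp 0) j (x + m) l = 0" for j x l m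
      using 3 by (cases "j = k"; cases j; cases k; simp)
    from trivial_if_GpGm_0[OF this] t_nonzero[OF nontrivial] show ?thesis by blast
  qed
qed

end

section \<open>Application to free modules of rank (1+1)\<close>

lemma (in super_module) free_of_rank_1_1_basis:
  assumes "free_of_rank 1 1"
  obtains e where "\<And>i v. v \<in> part i \<Longrightarrow> \<exists>q. v = scale q (e i)" "\<And>i q. scale q (e i) = 0 \<Longrightarrow> q = 0"
    "\<And>i. e i \<in> part i"
proof -
  obtain B C where B: "card B = 1" "independent B" "span B = part 0"
    and C: "card C = 1" "independent C" "span C = part 1"
    using assms unfolding free_of_rank_def by blast
  then obtain b c where bc: "B = {b}" "C = {c}" by (auto simp: card_1_singleton_iff)
  define e where "e i = (if i = 0 then b else c)" for i :: bit
  have e: "part i = span {e i}" "independent {e i}" for i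
    using B C bc by (cases i; simp add: e_def)+
  show thesis
  proof (rule that[of e])
    show "\<exists>q. v = scale q (e i)" if "v \<in> part i" for i v
      using that by (auto simp: e span_singleton)
    show "q = 0" if "scale q (e i) = 0" for i q
      using independentD[OF e(2)[of i], of "{e i}" "\<lambda>_. q"] that by simp
    show "e i \<in> part i" for i by (simp add: e span_base)
  qed
qed

theorem theorem4p4:
  fixes p s :: complex
    and sM :: "complex poly \<Rightarrow> 'm::ab_group_add \<Rightarrow> 'm"
    and pM :: "bit \<Rightarrow> 'm set"
    and act :: "K_elem \<Rightarrow> 'm \<Rightarrow> 'm poly"
  assumes "p \<noteq> 0"
    and "s ^ 2 = p"
    and "conformal_module fscale K_part (K_brk p) sM pM act"
    and "nontrivial_action act"
    and "super_module.free_of_rank sM pM 1 1"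
  shows "\<exists>\<Delta> \<alpha>. conformal_iso_up_to_parity sM pM act fscale V_part (V1_act p s \<Delta> \<alpha>) \<or>
               conformal_iso_up_to_parity sM pM act fscale V_part (V2_act p s \<Delta> \<alpha>)"
proof -
  interpret Mod: conformal_module fscale K_part "K_brk p" sM pM act by fact
  obtain e where "\<And>i v. v \<in> pM i \<Longrightarrow> \<exists>q. v = sM q (e i)" "\<And>i q. sM q (e i) = 0 \<Longrightarrow> q = 0"
    "\<And>i. e i \<in> pM i"
    using Mod.Act.M.free_of_rank_1_1_basis[OF assms(5)] by metis
  then interpret rank11_pair fscale K_part "K_brk p" sM pM act e
    by unfold_locales
  interpret K_rank11_module p sM pM act e
  proof
    show "jac i j a b v" if "a \<in> K_part i" "b \<in> K_part j" for a b i j v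
      using Mod.module_jacobi[OF that, of v] by (simp add: jac_def nest_def left_def)
  qed (fact assms)
  show ?thesis by (rule conformal_iso_V[OF assms(2,4)])
qed

end
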